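(* For any finite set $S$ of N-steps, the generating function $$B(x,y;t)=\sum_{w}x^{\min(w)}y^{\max(w)}t^{|w|},$$ summed over all N-bridges $w$ on $S$, is algebraic.
   Context: An N-step is a non-empty finite set of integers. Given a finite set $S$ of N-steps, an N-walk of length $n$ is a sequence $w=(s_1,\dots,s_n)$ of elements of $S$, starting at $0$; $|w|=n$. A classical walk $(v_1,\dots,v_n)$ of integers is compatible with $w$ if $v_i\in s_i$ for every $i$. The reachable points of $w$ are the endpoints $v_1+\cdots+v_n$ of all compatible classical walks (equivalently, the Minkowski sum $s_1+\cdots+s_n$); $\min(w)$ and $\max(w)$ are the minimum and maximum reachable point. An N-bridge is an N-walk for which $0$ is a reachable point. *)

theory Defs
  imports "HOL-Computational_Algebra.Computational_Algebra"
begin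

definition N_step :: "int set \<Rightarrow> bool" where
  "N_step s \<longleftrightarrow> finite s \<and> s \<noteq> {}"

definition N_walks :: "int set set \<Rightarrow> nat \<Rightarrow> int set list set" where
  "N_walks S n = {w. set w \<subseteq> S \<and> length w = n}"

definition compatible :: "int list \<Rightarrow> int set list \<Rightarrow> bool" where
  "compatible v w \<longleftrightarrow> list_all2 (\<in>) v w"

definition reachable :: "int set list \<Rightarrow> int set" where
  "reachable w = {sum_list v | v. compatible v w}"

(* The empty walk counts as a bridge: its only reachable point is 0. *)
definition N_bridges :: "int set set \<Rightarrow> nat \<Rightarrow> int set list set" where
  "N_bridges S n = {w \<in> N_walks S n. 0 \<in> reachable w}"

(* Since min(w) is at most 0 on bridges, the coefficient of each power of t is a Laurent polynomial
   in x and y. We place it in the field of rational functions in x and y, i.e. the fraction field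
   of Q[x][y], and B itself in the ring of formal power series in t over that field. *)
type_synonym ratfun_xy = "rat poly poly fract"

definition var_x :: ratfun_xy where
  "var_x = to_fract [:[:0, 1:]:]"

definition var_y :: ratfun_xy where
  "var_y = to_fract [:0, 1:]"

definition N_bridge_gf :: "int set set \<Rightarrow> ratfun_xy fps" where
  "N_bridge_gf S = Abs_fps (\<lambda>n. \<Sum>w\<in>N_bridges S n.
     var_x powi Min (reachable w) * var_y powi Max (reachable w))"

(* The canonical embedding of Q[x][y][t]; the outermost polynomial variable is t. *)
definition embed_xyt :: "rat poly poly poly \<Rightarrow> ratfun_xy fps" where
  "embed_xyt c = fps_of_poly (map_poly to_fract c)"

(* F satisfies P(x,y,t,F) = 0 for some nonzero polynomial P in Q[x][y][t][z]. *)
definition algebraic_xyt :: "ratfun_xy fps \<Rightarrow> bool" where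
  "algebraic_xyt F \<longleftrightarrow>
     (\<exists>P :: rat poly poly poly poly. P \<noteq> 0 \<and> poly (map_poly embed_xyt P) F = 0)"

end

theory Submission
  imports "HOL-Algebra.Algebraic_Closure_Type" "HOL-Library.Groups_Big_Fun"
    "Jordan_Normal_Form.Determinant" Defs
begin

text \<open>The reachable points of a walk are a finite union of arithmetic progressions that start near the
  minimum and end near the maximum; which ones occur depends only on the number of occurrences of each
  N-step, counted up to a threshold and then modulo a period. Hence, among the walks in one state of a
  finite automaton, the bridges are those whose minimum and maximum lie in a finite union of quadrants,
  and a quadrant reduces to lower bounds on a single additive weight.

  The series of the walks in a given state whose weight is at least \<open>c\<close> is the nonnegative part of
  a rational function in the catalytic variable. By a kernel argument, it is determined by divisibility
  by two divisors of the kernel polynomial, which collect its small and its large roots. Their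
  coefficients are algebraic, and so is the nonnegative part.\<close>

section \<open>Algebraic elements over a subfield\<close>

text \<open>A bound on an additive weight calls for a catalytic variable u that marks the weight,
  and the kernel argument copes with one such variable only: two independent bounds describe walks
  in a quadrant, whose series need not be algebraic. Therefore x and y stay in the coefficient
  field, u is introduced afresh for each single bound, and the finite state has to carry enough
  information for single bounds to suffice.

  The roots of the kernel would be Puiseux series in t. Instead of constructing them, the proof
  stays with Laurent series in t and characterises each of the two divisors by the expansions that
  exist after division by the kernel. An algebraic closure enters only to see that divisors have
  algebraic coefficients. Series in u extend in both directions and cannot be multiplied with each
  other; what survives is the action of polynomials, and a decay condition restores cancellation.

  Subfields are sets inside one ambient field, so that rational functions, algebraic series and
  arbitrary Laurent series share a type.\<close>

locale subfield_set =
  fixes k :: "'a :: field set"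
  assumes zero_mem [simp]: "0 \<in> k"
    and one_mem [simp]: "1 \<in> k"
    and add_mem: "x \<in> k \<Longrightarrow> y \<in> k \<Longrightarrow> x + y \<in> k"
    and mult_mem: "x \<in> k \<Longrightarrow> y \<in> k \<Longrightarrow> x * y \<in> k"
    and uminus_mem: "x \<in> k \<Longrightarrow> - x \<in> k"
    and inverse_mem: "x \<in> k \<Longrightarrow> inverse x \<in> k"
begin

lemma diff_mem: "x \<in> k \<Longrightarrow> y \<in> k \<Longrightarrow> x - y \<in> k"
  using add_mem[of x "- y"] uminus_mem[of y] by simp

lemma divide_mem: "x \<in> k \<Longrightarrow> y \<in> k \<Longrightarrow> x / y \<in> k"
  using mult_mem[of x "inverse y"] inverse_mem[of y] by (simp add: field_simps)

lemma sum_mem: "(\<And>i. i \<in> I \<Longrightarrow> f i \<in> k) \<Longrightarrow> sum f I \<in> k"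
  by (induction I rule: infinite_finite_induct) (auto intro: add_mem)

text \<open>Gaussian elimination, one equation at a time: the unknown at the pivot \<open>p\<close>
  is eliminated from the other equations, which preserves the surplus of unknowns and never leaves
  \<open>k\<close>.\<close>

lemma homogeneous_system_solvable:
  fixes m :: "'j \<Rightarrow> 'i \<Rightarrow> 'a"
  assumes "finite J" "finite I" "card J < card I" "\<And>j i. j \<in> J \<Longrightarrow> i \<in> I \<Longrightarrow> m j i \<in> k"
  shows "\<exists>c. (\<forall>i\<in>I. c i \<in> k) \<and> (\<exists>i\<in>I. c i \<noteq> 0) \<and> (\<forall>j\<in>J. (\<Sum>i\<in>I. m j i * c i) = 0)"
  using assms
proof (induction J arbitrary: I m rule: finite_induct)
  case empty
  then obtain i where "i \<in> I" by (metis card.empty equals0I less_irrefl)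
  then show ?case by (intro exI[of _ "\<lambda>_. 1"]) auto
next
  case (insert j J)
  show ?case
  proof (cases "\<forall>i\<in>I. m j i = 0")
    case True
    have "card J < card I" using insert by simp
    then obtain c where "\<forall>i\<in>I. c i \<in> k" "\<exists>i\<in>I. c i \<noteq> 0" "\<forall>j\<in>J. (\<Sum>i\<in>I. m j i * c i) = 0"
      using insert.IH[of I m] insert.prems by blast
    then show ?thesis using True by (intro exI[of _ c]) auto
  next
    case False
    then obtain p where p: "p \<in> I" "m j p \<noteq> 0" by blast
    let ?I = "I - {p}"
    let ?m = "\<lambda>l i. m l i - m l p * m j i / m j p"
    have "card J < card ?I" using insert p by simp
    moreover have "?m l i \<in> k" if "l \<in> J" "i \<in> ?I" for l i
      using that p insert.prems by (auto intro!: diff_mem divide_mem mult_mem)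
    ultimately obtain c where c: "\<forall>i\<in>?I. c i \<in> k" "\<exists>i\<in>?I. c i \<noteq> 0"
      "\<forall>l\<in>J. (\<Sum>i\<in>?I. ?m l i * c i) = 0"
      using insert.IH[of ?I ?m] insert.prems by auto
    define s where "s = (\<Sum>i\<in>?I. m j i * c i)"
    define d where "d = (\<lambda>i. if i = p then - s / m j p else c i)"
    have s: "s \<in> k" unfolding s_def using c insert.prems by (auto intro!: sum_mem mult_mem)
    have split: "(\<Sum>i\<in>I. m l i * d i) = (\<Sum>i\<in>?I. m l i * c i) - m l p * (s / m j p)" for l
    proof -
      have "(\<Sum>i\<in>I. m l i * d i) = m l p * d p + (\<Sum>i\<in>?I. m l i * d i)"
        using p insert.prems by (intro sum.remove) auto
      also have "(\<Sum>i\<in>?I. m l i * d i) = (\<Sum>i\<in>?I. m l i * c i)"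
        by (intro sum.cong) (auto simp: d_def)
      finally show ?thesis by (simp add: d_def)
    qed
    have "(\<Sum>i\<in>I. m l i * d i) = 0" if l: "l \<in> insert j J" for l
    proof (cases "l = j")
      case True
      then show ?thesis unfolding split using p by (simp add: s_def)
    next
      case False
      then have "(\<Sum>i\<in>?I. ?m l i * c i) = 0" using c l by blast
      moreover have "(\<Sum>i\<in>?I. ?m l i * c i) = (\<Sum>i\<in>?I. m l i * c i) - m l p * (s / m j p)"
        unfolding s_def by (simp add: algebra_simps sum_subtractf sum_divide_distrib sum_distrib_left)
      ultimately show ?thesis unfolding split by simp
    qed
    moreover have "\<forall>i\<in>I. d i \<in> k" using c s p insert.prems
      by (auto simp: d_def intro!: divide_mem uminus_mem)
    moreover have "\<exists>i\<in>I. d i \<noteq> 0" using c by (auto simp: d_def)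
    ultimately show ?thesis by blast
  qed
qed

definition kspan :: "('i \<Rightarrow> 'a) \<Rightarrow> 'i set \<Rightarrow> 'a set" where
  "kspan v I = {\<Sum>i\<in>I. c i * v i | c. \<forall>i\<in>I. c i \<in> k}"

lemma kspan_base: "finite I \<Longrightarrow> i \<in> I \<Longrightarrow> v i \<in> kspan v I"
  unfolding kspan_def
  by (intro CollectI exI[of _ "\<lambda>j. if j = i then 1 else 0"]) (auto simp: if_distrib if_distribR cong: if_cong)

lemma kspan_add: "x \<in> kspan v I \<Longrightarrow> y \<in> kspan v I \<Longrightarrow> x + y \<in> kspan v I"
  unfolding kspan_def
  apply clarify
  subgoal for c d
    by (intro exI[of _ "\<lambda>i. c i + d i"]) (auto simp: sum.distrib algebra_simps intro: add_mem)
  done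

lemma kspan_scale: "a \<in> k \<Longrightarrow> x \<in> kspan v I \<Longrightarrow> a * x \<in> kspan v I"
  unfolding kspan_def
  apply clarify
  subgoal for c
    by (intro exI[of _ "\<lambda>i. a * c i"]) (auto simp: sum_distrib_left algebra_simps intro: mult_mem)
  done

lemma kspan_zero: "0 \<in> kspan v I"
  unfolding kspan_def by (intro CollectI exI[of _ "\<lambda>_. 0"]) auto

lemma kspan_sum: "(\<And>j. j \<in> J \<Longrightarrow> f j \<in> kspan v I) \<Longrightarrow> sum f J \<in> kspan v I"
  by (induction J rule: infinite_finite_induct) (auto intro: kspan_add kspan_zero)

lemma kspan_stable:
  assumes "\<And>i. i \<in> I \<Longrightarrow> x * v i \<in> kspan v I" "y \<in> kspan v I"
  shows "x * y \<in> kspan v I"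
proof -
  obtain c where c: "y = (\<Sum>i\<in>I. c i * v i)" "\<forall>i\<in>I. c i \<in> k"
    using assms(2) unfolding kspan_def by blast
  have "x * y = (\<Sum>i\<in>I. c i * (x * v i))"
    unfolding c by (simp add: sum_distrib_left algebra_simps)
  also have "\<dots> \<in> kspan v I" by (rule kspan_sum, rule kspan_scale) (use c(2) assms(1) in auto)
  finally show ?thesis .
qed

definition algs :: "'a set" where
  "algs = {x. \<exists>P. P \<noteq> 0 \<and> (\<forall>i. coeff P i \<in> k) \<and> poly P x = 0}"

text \<open>All products \<open>x ^ n * v i0\<close> lie in the span of \<open>card I\<close>
  elements. Those with \<open>n \<le> card I\<close> are one too many to be independent, and a
  dependence among them becomes an equation for \<open>x\<close> once the nonzero factor
  \<open>v i0\<close> is cancelled.\<close>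

lemma algs_if_stable_span:
  assumes "finite I" "i0 \<in> I" "v i0 \<noteq> 0" "\<And>i. i \<in> I \<Longrightarrow> x * v i \<in> kspan v I"
  shows "x \<in> algs"
proof -
  have "x ^ n * v i0 \<in> kspan v I" for n
  proof (induction n)
    case 0
    then show ?case using assms kspan_base by simp
  next
    case (Suc n)
    then show ?case using kspan_stable[of I x v] assms(4) by (simp add: mult.assoc)
  qed
  then have "\<exists>c. x ^ n * v i0 = (\<Sum>i\<in>I. c i * v i) \<and> (\<forall>i\<in>I. c i \<in> k)" for n
    unfolding kspan_def by blast
  then obtain c where c: "\<And>n. x ^ n * v i0 = (\<Sum>i\<in>I. c n i * v i)" "\<And>n i. i \<in> I \<Longrightarrow> c n i \<in> k"
    by metis
  have "\<exists>d. (\<forall>n\<in>{..card I}. d n \<in> k) \<and> (\<exists>n\<in>{..card I}. d n \<noteq> 0) \<and>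
      (\<forall>i\<in>I. (\<Sum>n\<le>card I. c n i * d n) = 0)"
    using assms(1) c(2) by (intro homogeneous_system_solvable) auto
  then obtain d where d: "\<And>n. n \<le> card I \<Longrightarrow> d n \<in> k" "\<exists>n\<le>card I. d n \<noteq> 0"
    "\<And>i. i \<in> I \<Longrightarrow> (\<Sum>n\<le>card I. c n i * d n) = 0"
    by blast
  define P where "P = (\<Sum>n\<le>card I. monom (d n) n)"
  have cP: "coeff P n = (if n \<le> card I then d n else 0)" for n
    unfolding P_def by (simp add: coeff_sum)
  have "poly P x * v i0 = (\<Sum>n\<le>card I. d n * (x ^ n * v i0))"
    unfolding P_def by (simp add: poly_sum poly_monom sum_distrib_right mult.assoc)
  also have "\<dots> = (\<Sum>i\<in>I. (\<Sum>n\<le>card I. c n i * d n) * v i)"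
    unfolding c by (simp add: sum_distrib_left sum_distrib_right sum.swap[of _ I] mult_ac)
  also have "\<dots> = 0" using d by simp
  finally have "poly P x = 0" using assms by simp
  moreover have "P \<noteq> 0" using d(2) cP by (metis coeff_0)
  moreover have "\<forall>i. coeff P i \<in> k" using d(1) cP by simp
  ultimately show ?thesis unfolding algs_def by blast
qed

text \<open>Solving for the top power gives a rule that rewrites \<open>x ^ d\<close> in lower
  powers. The degree is positive because a nonzero constant has no root.\<close>

lemma algs_obtain_relation:
  assumes "x \<in> algs"
  obtains d c where "d > 0" "\<And>i. i < d \<Longrightarrow> c i \<in> k" "x ^ d = (\<Sum>i<d. c i * x ^ i)"
proof -
  obtain P where P: "P \<noteq> 0" "\<And>i. coeff P i \<in> k" "poly P x = 0" using assms unfolding algs_def by blast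
  have "degree P > 0"
  proof (rule ccontr)
    assume "\<not> degree P > 0"
    then obtain a where "P = [:a:]" by (metis degree_eq_zeroE neq0_conv)
    then show False using P by simp
  qed
  moreover have "0 = coeff P (degree P) * x ^ degree P + (\<Sum>i<degree P. coeff P i * x ^ i)"
    using P(3) unfolding poly_altdef by (simp add: add.commute flip: lessThan_Suc_atMost)
  then have "lead_coeff P * x ^ degree P = - (\<Sum>i<degree P. coeff P i * x ^ i)"
    by (metis eq_neg_iff_add_eq_0)
  then have "x ^ degree P = - (\<Sum>i<degree P. coeff P i * x ^ i) / coeff P (degree P)"
    using P(1) by (metis leading_coeff_0_iff nonzero_mult_div_cancel_left)
  then have "x ^ degree P = (\<Sum>i<degree P. (- coeff P i / coeff P (degree P)) * x ^ i)"
    by (simp add: sum_negf sum_divide_distrib)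
  ultimately show thesis using that[of "degree P" "\<lambda>i. - coeff P i / coeff P (degree P)"] P(2)
    by (auto intro: divide_mem uminus_mem)
qed

lemma mem_algs: "x \<in> k \<Longrightarrow> x \<in> algs"
  unfolding algs_def using uminus_mem[of x]
  by (intro CollectI exI[of _ "[:- x, 1:]"]) (auto simp: coeff_pCons split: nat.splits)

text \<open>The products \<open>a ^ i * b ^ j\<close> with \<open>i < d\<close> and
  \<open>j < e\<close> span a space that multiplication by \<open>a\<close> and by \<open>b\<close>
  preserves, hence also multiplication by \<open>a + b\<close> and \<open>a * b\<close>.\<close>

lemma algs_add_mult:
  assumes "a \<in> algs" "b \<in> algs"
  shows "a + b \<in> algs" "a * b \<in> algs"
proof -
  obtain d c where d: "d > 0" "\<And>i. i < d \<Longrightarrow> c i \<in> k" "a ^ d = (\<Sum>i<d. c i * a ^ i)"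
    using algs_obtain_relation[OF assms(1)] by blast
  obtain e c' where e: "e > 0" "\<And>i. i < e \<Longrightarrow> c' i \<in> k" "b ^ e = (\<Sum>i<e. c' i * b ^ i)"
    using algs_obtain_relation[OF assms(2)] by blast
  let ?I = "{..<d} \<times> {..<e}"
  let ?v = "\<lambda>(i, j). a ^ i * b ^ j"
  have base: "a ^ i * b ^ j \<in> kspan ?v ?I" if "i < d" "j < e" for i j
    using kspan_base[of ?I "(i, j)" ?v] that by simp
  have A: "a * ?v p \<in> kspan ?v ?I" if "p \<in> ?I" for p
  proof -
    obtain i j where p: "p = (i, j)" "i < d" "j < e" using \<open>p \<in> ?I\<close> by auto
    show ?thesis
    proof (cases "Suc i < d")
      case True
      then show ?thesis using p base[of "Suc i" j] by (simp add: mult.assoc)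
    next
      case False
      then have "Suc i = d" using p by simp
      then have "a * ?v p = a ^ d * b ^ j" using p by (auto simp: mult.assoc)
      also have "\<dots> = (\<Sum>l<d. c l * (a ^ l * b ^ j))" unfolding d(3) by (simp add: sum_distrib_right mult.assoc)
      also have "\<dots> \<in> kspan ?v ?I" by (rule kspan_sum, rule kspan_scale) (use d(2) base p in auto)
      finally show ?thesis .
    qed
  qed
  have B: "b * ?v p \<in> kspan ?v ?I" if "p \<in> ?I" for p
  proof -
    obtain i j where p: "p = (i, j)" "i < d" "j < e" using \<open>p \<in> ?I\<close> by auto
    show ?thesis
    proof (cases "Suc j < e")
      case True
      then show ?thesis using p base[of i "Suc j"] by (simp add: mult_ac)
    next
      case False
      then have "Suc j = e" using p by simp
      then have "b * ?v p = a ^ i * b ^ e" using p by (auto simp: mult_ac)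
      also have "\<dots> = (\<Sum>l<e. c' l * (a ^ i * b ^ l))" unfolding e(3) by (simp add: sum_distrib_left mult_ac)
      also have "\<dots> \<in> kspan ?v ?I" by (rule kspan_sum, rule kspan_scale) (use e(2) base p in auto)
      finally show ?thesis .
    qed
  qed
  have *: "finite ?I" "(0, 0) \<in> ?I" "?v (0, 0) \<noteq> 0" using d e by auto
  show "a + b \<in> algs"
    by (rule algs_if_stable_span[where v = ?v, OF *]) (use A B in \<open>auto simp: distrib_right intro!: kspan_add\<close>)
  show "a * b \<in> algs"
    by (rule algs_if_stable_span[where v = ?v, OF *])
      (unfold mult.assoc, rule kspan_stable, use A B in auto)
qed

lemma algs_inverse:
  assumes "a \<in> algs"
  shows "inverse a \<in> algs"
proof (cases "a = 0")
  case True
  then show ?thesis using mem_algs by simp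
next
  case False
  obtain P where P: "P \<noteq> 0" "\<And>i. coeff P i \<in> k" "poly P a = 0" using assms unfolding algs_def by blast
  have "poly (reflect_poly P) (inverse a) = 0"
    using P False poly_reflect_poly_nz[of "inverse a" P] by simp
  moreover have "coeff (reflect_poly P) i \<in> k" for i
    using P by (simp add: coeff_reflect_poly)
  ultimately show ?thesis unfolding algs_def using P by (intro CollectI exI[of _ "reflect_poly P"]) auto
qed

lemma subfield_algs: "subfield_set algs"
proof
  show "- x \<in> algs" if "x \<in> algs" for x
    using algs_add_mult(2)[of "- 1" x] that mem_algs[OF uminus_mem[OF one_mem]] by simp
qed (auto intro: mem_algs algs_add_mult algs_inverse)

end

lemma (in subfield_set) subfield_image_to_ac: "subfield_set (to_ac ` k)"
proof
  show "x + y \<in> to_ac ` k" if "x \<in> to_ac ` k" "y \<in> to_ac ` k" for x y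
    using that add_mem by (auto simp flip: to_ac_add)
  show "x * y \<in> to_ac ` k" if "x \<in> to_ac ` k" "y \<in> to_ac ` k" for x y
    using that mult_mem by (auto simp flip: to_ac_mult)
  show "- x \<in> to_ac ` k" if "x \<in> to_ac ` k" for x
    using that uminus_mem by (auto simp flip: to_ac_minus)
  show "inverse x \<in> to_ac ` k" if "x \<in> to_ac ` k" for x
    using that inverse_mem by (auto simp flip: to_ac_inverse)
qed (auto intro: rev_image_eqI[of 0] rev_image_eqI[of 1])

lemma map_poly_to_ac_mult: "map_poly to_ac (p * q) = map_poly to_ac p * map_poly to_ac q"
  by (rule poly_eqI) (simp add: coeff_map_poly coeff_mult to_ac_sum)

lemma poly_map_poly_to_ac: "poly (map_poly to_ac p) (to_ac x) = to_ac (poly p x)"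
  by (induction p) (simp_all add: map_poly_pCons)

text \<open>Over an algebraic closure, a monic divisor of a polynomial over the subfield is a product
  of linear factors whose roots are algebraic, so its coefficients are algebraic too.\<close>
lemma (in subfield_set) coeff_monic_dvd_mem_algs:
  assumes "\<And>i. coeff P i \<in> k" "P \<noteq> 0" "V dvd P" "lead_coeff V = 1"
  shows "coeff V i \<in> algs"
proof -
  interpret K: subfield_set "to_ac ` k" by (rule subfield_image_to_ac)
  interpret KA: subfield_set K.algs by (rule K.subfield_algs)
  let ?V = "map_poly to_ac V"
  have "V \<noteq> 0" using assms by auto
  have dV: "degree ?V = degree V" by (simp add: degree_map_poly)
  then have "lead_coeff ?V = 1" using assms by (simp add: coeff_map_poly)
  then have "?V \<noteq> 0" by auto
  then obtain A where A: "?V = smult (lead_coeff ?V) (\<Prod>x\<in>#A. [:- x, 1:])"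
    using alg_closed_imp_factorization by blast
  then have A: "?V = (\<Prod>x\<in>#A. [:- x, 1:])" using \<open>lead_coeff ?V = 1\<close> by simp
  have root: "x \<in> K.algs" if "x \<in># A" for x
  proof -
    have "[:- x, 1:] dvd ?V" unfolding A using that by (intro dvd_prod_mset) auto
    also have "?V dvd map_poly to_ac P"
      using assms(3) unfolding dvd_def by (auto simp: map_poly_to_ac_mult)
    finally have "poly (map_poly to_ac P) x = 0" by (simp add: poly_eq_0_iff_dvd)
    moreover have "map_poly to_ac P \<noteq> 0"
      using assms(2) by (metis coeff_map_poly leading_coeff_0_iff to_ac_0 to_ac_eq_0_iff coeff_0)
    ultimately show ?thesis unfolding K.algs_def using assms(1)
      by (intro CollectI exI[of _ "map_poly to_ac P"]) (auto simp: coeff_map_poly)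
  qed
  have "coeff (\<Prod>x\<in>#A. [:- x, 1:]) i \<in> K.algs" for i using root
  proof (induction A arbitrary: i)
    case empty
    then show ?case by (auto simp: coeff_pCons split: nat.splits simp flip: one_pCons)
  next
    case (add x A)
    then show ?case
      by (auto simp: coeff_pCons split: nat.splits intro!: KA.diff_mem KA.add_mem KA.mult_mem KA.uminus_mem)
  qed
  then have "to_ac (coeff V i) \<in> K.algs" using A by (metis coeff_map_poly to_ac_0)
  then obtain Q where Q: "Q \<noteq> 0" "\<And>j. coeff Q j \<in> to_ac ` k" "poly Q (to_ac (coeff V i)) = 0"
    unfolding K.algs_def by blast
  \<comment> \<open>The equation was found over the closure, but its coefficients lie in the image
    of \<open>k\<close>, so \<open>of_ac\<close> carries it back to the original field.\<close>
  define Q' where "Q' = map_poly of_ac Q"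
  have cQ': "coeff Q' j \<in> k" "to_ac (coeff Q' j) = coeff Q j" for j
    using Q(2)[of j] by (auto simp: Q'_def coeff_map_poly)
  have "Q = map_poly to_ac Q'" by (rule poly_eqI) (simp add: coeff_map_poly cQ')
  then have "poly Q' (coeff V i) = 0" "Q' \<noteq> 0"
    using Q by (auto simp: poly_map_poly_to_ac)
  then show ?thesis unfolding algs_def using cQ' by blast
qed

section \<open>Polynomials over a subfield\<close>

context subfield_set
begin

definition polys :: "'a poly set" where
  "polys = {p. \<forall>i. coeff p i \<in> k}"

lemma polys_0 [simp]: "0 \<in> polys" and polys_add: "p \<in> polys \<Longrightarrow> q \<in> polys \<Longrightarrow> p + q \<in> polys"
  and polys_diff: "p \<in> polys \<Longrightarrow> q \<in> polys \<Longrightarrow> p - q \<in> polys"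
  and polys_smult: "a \<in> k \<Longrightarrow> p \<in> polys \<Longrightarrow> smult a p \<in> polys"
  and polys_pCons: "pCons a p \<in> polys \<longleftrightarrow> a \<in> k \<and> p \<in> polys"
  by (auto simp: polys_def add_mem diff_mem mult_mem coeff_pCons split: nat.splits)

lemma polys_mult: "p \<in> polys \<Longrightarrow> q \<in> polys \<Longrightarrow> p * q \<in> polys"
  by (induction p) (auto simp: polys_pCons intro!: polys_add polys_smult)

text \<open>The division algorithm divides only by the leading coefficient of \<open>q\<close>, so
  it never leaves \<open>k\<close>.\<close>

lemma polys_div_mod:
  assumes "p \<in> polys" "q \<in> polys"
  shows "p div q \<in> polys \<and> p mod q \<in> polys"
proof (cases "q = 0")
  case True
  then show ?thesis using assms by simp
next
  case False
  show ?thesis using assms(1)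
  proof (induction p)
    case 0
    then show ?case by simp
  next
    case (pCons a p)
    then have a: "a \<in> k" and dm: "p div q \<in> polys" "p mod q \<in> polys" by (auto simp: polys_pCons)
    define c where "c = coeff (pCons a (p mod q)) (degree q) / lead_coeff q"
    have c: "c \<in> k" unfolding c_def using a dm assms(2)
      by (intro divide_mem) (auto simp: polys_def coeff_pCons split: nat.splits)
    show ?case using c a dm assms(2) False
      by (auto simp: div_pCons_eq mod_pCons polys_pCons simp flip: c_def intro!: polys_diff polys_smult)
  qed
qed

text \<open>The Euclidean algorithm for \<open>p\<close> and \<open>q\<close> runs inside
  \<open>polys\<close>, so cofactors over the large field can be exchanged for cofactors over
  \<open>k\<close>. The measure separates \<open>q = 0\<close> from nonzero constants.\<close>

lemma polys_bezout_descent: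
  assumes "p \<in> polys" "q \<in> polys" "n \<in> polys" "n = p * a + q * b"
  shows "\<exists>a'\<in>polys. \<exists>b'\<in>polys. n = p * a' + q * b'"
  using assms
proof (induction "if q = 0 then 0 else Suc (degree q)" arbitrary: p q a b rule: less_induct)
  case less
  show ?case
  proof (cases "q = 0")
    case True
    show ?thesis
    proof (cases "p = 0")
      case True
      then show ?thesis using less.prems \<open>q = 0\<close> by (intro bexI[of _ 0]) auto
    next
      case False
      then have "n div p = a" using less.prems True by simp
      then have "a \<in> polys" using polys_div_mod[OF less.prems(3,1)] by simp
      then show ?thesis using less.prems True by (intro bexI[of _ a] bexI[of _ 0]) auto
    qed
  next
    case False
    have pq: "p = q * (p div q) + p mod q" by simp
    have "(if p mod q = 0 then 0 else Suc (degree (p mod q))) < (if q = 0 then 0 else Suc (degree q))"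
      using False degree_mod_less[of q p] by auto
    moreover have "n = q * (p div q * a + b) + p mod q * a"
    proof -
      have "n = (q * (p div q) + p mod q) * a + q * b" using less.prems(4) pq by simp
      then show ?thesis by (simp only: algebra_simps)
    qed
    ultimately obtain a' b' where ab: "a' \<in> polys" "b' \<in> polys" "n = q * a' + (p mod q) * b'"
      using less.hyps[of "p mod q" q] less.prems polys_div_mod by blast
    have "n = p * b' + q * (a' - p div q * b')"
    proof -
      have "n = q * a' + (p - q * (p div q)) * b'" using ab(3) by (simp only: minus_mult_div_eq_mod)
      also have "q * a' + (p - q * d) * b' = p * b' + q * (a' - d * b')" for d
        by (simp add: algebra_simps)
      finally show ?thesis .
    qed
    moreover have "a' - p div q * b' \<in> polys"
      using ab(1,2) polys_div_mod[OF less.prems(1,2)] by (simp add: polys_diff polys_mult)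
    ultimately show ?thesis using ab(2) by blast
  qed
qed

end

unbundle fps_syntax

section \<open>Polynomials acting on doubly infinite sequences\<close>

text \<open>The sequence \<open>f\<close> stands for the bilateral series with coefficient
  \<open>f i\<close> at u^i, and \<open>conv p f\<close> is its product with p(u). Sequences thus
  form a module over the polynomials in u.\<close>

definition conv :: "'b::comm_ring_1 poly \<Rightarrow> (int \<Rightarrow> 'b) \<Rightarrow> int \<Rightarrow> 'b" where
  "conv p f i = (\<Sum>j\<le>degree p. coeff p j * f (i - int j))"

text \<open>The series 1, so that \<open>conv p \<delta>\<close> is the polynomial \<open>p\<close>
  read as a sequence.\<close>

definition \<delta> :: "int \<Rightarrow> 'b::comm_ring_1" where
  "\<delta> i = (if i = 0 then 1 else 0)"

lemma conv_bound: "degree p \<le> n \<Longrightarrow> conv p f i = (\<Sum>j\<le>n. coeff p j * f (i - int j))"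
  unfolding conv_def by (rule sum.mono_neutral_left) (auto simp: coeff_eq_0)

lemma conv_0 [simp]: "conv 0 f = (\<lambda>_. 0)"
  by (simp add: conv_def fun_eq_iff)

lemma conv_zero [simp]: "conv p (\<lambda>_. 0) = (\<lambda>_. 0)"
  by (simp add: conv_def fun_eq_iff)

lemma conv_add: "conv (p + q) f i = conv p f i + conv q f i"
proof -
  define n where "n = max (degree p) (degree q)"
  have "degree p \<le> n" "degree q \<le> n" "degree (p + q) \<le> n"
    by (auto simp: n_def degree_add_le)
  then show ?thesis by (simp add: conv_bound[where n = n] sum.distrib distrib_right)
qed

lemma conv_smult: "conv (smult a p) f i = a * conv p f i"
  using degree_smult_le[of a p] by (simp add: conv_bound[where n = "degree p"] sum_distrib_left mult.assoc)

lemma conv_pCons: "conv (pCons a p) f i = a * f i + conv p f (i - 1)"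
proof -
  have "conv (pCons a p) f i = (\<Sum>j\<le>Suc (degree p). coeff (pCons a p) j * f (i - int j))"
    by (rule conv_bound) (rule degree_pCons_le)
  also have "\<dots> = a * f i + (\<Sum>j\<le>degree p. coeff p j * f (i - 1 - int j))"
    by (subst sum.atMost_Suc_shift) (simp add: algebra_simps)
  finally show ?thesis by (simp add: conv_def)
qed

lemma conv_mult: "conv (p * q) f i = conv p (conv q f) i"
  by (induction p arbitrary: i) (auto simp: mult_pCons_left conv_add conv_smult conv_pCons)

lemma conv_uminus: "conv (- p) f i = - conv p f i"
  using conv_smult[of "- 1" p f i] by simp

lemma conv_diff: "conv (p - q) f i = conv p f i - conv q f i"
  using conv_add[of p "- q" f i] by (simp add: conv_uminus)

lemma conv_sum_left: "conv (sum p A) f i = (\<Sum>a\<in>A. conv (p a) f i)"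
  by (induction A rule: infinite_finite_induct) (auto simp: conv_add)

lemma conv_add_right: "conv p (\<lambda>i. f i + g i) i = conv p f i + conv p g i"
  by (simp add: conv_def sum.distrib algebra_simps)

lemma conv_diff_right: "conv p (\<lambda>i. f i - g i) i = conv p f i - conv p g i"
  by (simp add: conv_def sum_subtractf algebra_simps)

lemma conv_sum_right: "conv p (\<lambda>i. \<Sum>a\<in>A. f a i) i = (\<Sum>a\<in>A. conv p (f a) i)"
  by (induction A rule: infinite_finite_induct) (auto simp: conv_add_right)

lemma conv_shift: "conv p (\<lambda>i. f (i + c)) i = conv p f (i + c)"
  by (simp add: conv_def algebra_simps)

lemma conv_monom: "conv (monom a n) f i = a * f (i - int n)"
proof -
  have "conv (monom a n) f i = (\<Sum>j\<le>n. coeff (monom a n) j * f (i - int j))"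
    by (rule conv_bound) (rule degree_monom_le)
  also have "\<dots> = (\<Sum>j\<in>{n}. coeff (monom a n) j * f (i - int j))"
    by (rule sum.mono_neutral_right) auto
  finally show ?thesis by simp
qed

lemma conv_delta: "conv p \<delta> i = (if i \<ge> 0 then coeff p (nat i) else 0)"
proof -
  have "conv p \<delta> i = (\<Sum>j\<le>degree p. if int j = i then coeff p j else 0)"
    unfolding conv_def \<delta>_def by (rule sum.cong) auto
  also have "\<dots> = (\<Sum>j\<in>{j. j \<le> degree p \<and> int j = i}. coeff p j)"
    by (rule sum.mono_neutral_cong_right) auto
  also have "{j. j \<le> degree p \<and> int j = i} = (if i \<ge> 0 \<and> nat i \<le> degree p then {nat i} else {})"
    by auto
  finally show ?thesis by (auto simp: coeff_eq_0)
qed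

lemma conv_delta_inject: "conv p \<delta> = conv q \<delta> \<Longrightarrow> p = q"
  by (rule poly_eqI) (metis conv_delta nat_int of_nat_0_le_iff)

lemma finite_support_conv_delta:
  fixes f :: "int \<Rightarrow> 'b::comm_ring_1"
  assumes "\<And>i. i < 0 \<Longrightarrow> f i = 0" "\<And>i. i > int n \<Longrightarrow> f i = 0"
  shows "f = conv (\<Sum>j\<le>n. monom (f (int j)) j) \<delta>"
proof
  fix i
  show "f i = conv (\<Sum>j\<le>n. monom (f (int j)) j) \<delta> i"
    using assms[of i] by (cases "i < 0") (auto simp: conv_delta coeff_sum)
qed

lemma conv_eq_0_below:
  assumes "\<And>i. i < b \<Longrightarrow> f i = 0" "i < b"
  shows "conv p f i = 0"
  unfolding conv_def by (rule sum.neutral) (use assms in auto)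

lemma conv_eq_0_above:
  assumes "\<And>i. i > b \<Longrightarrow> f i = 0" "i > b + int (degree p)"
  shows "conv p f i = 0"
  unfolding conv_def by (rule sum.neutral) (use assms in auto)

section \<open>Bilateral sequences that tend to zero, and cancellation of polynomials\<close>

text \<open>In the topology of Laurent series the entries tend to 0 in both directions. On all
  sequences polynomials can have a kernel: 1 - u kills the constant sequence 1.\<close>

definition decaying :: "(int \<Rightarrow> 'a::field fls) \<Rightarrow> bool" where
  "decaying f \<longleftrightarrow> (\<forall>n. finite {i. \<exists>m<n. f i $$ m \<noteq> 0})"

lemma decaying_add: "decaying f \<Longrightarrow> decaying g \<Longrightarrow> decaying (\<lambda>i. f i + g i)"
  unfolding decaying_def
proof
  fix n
  assume "\<forall>n. finite {i. \<exists>m<n. f i $$ m \<noteq> 0}" "\<forall>n. finite {i. \<exists>m<n. g i $$ m \<noteq> 0}"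
  then have "finite ({i. \<exists>m<n. f i $$ m \<noteq> 0} \<union> {i. \<exists>m<n. g i $$ m \<noteq> 0})" by simp
  then show "finite {i. \<exists>m<n. (f i + g i) $$ m \<noteq> 0}" by (rule rev_finite_subset) auto
qed

lemma decaying_scale: "decaying f \<Longrightarrow> decaying (\<lambda>i. a * f i)"
  unfolding decaying_def
proof
  fix n
  assume *: "\<forall>n. finite {i. \<exists>m<n. f i $$ m \<noteq> 0}"
  \<comment> \<open>The order of a product is at least the sum of the orders, so the cut-off
    \<open>n\<close> moves by the order of \<open>a\<close>.\<close>
  have "{i. \<exists>m<n. (a * f i) $$ m \<noteq> 0} \<subseteq> {i. \<exists>m<n - fls_subdegree a. f i $$ m \<noteq> 0}"
  proof clarify
    fix i m assume m: "m < n" "(a * f i) $$ m \<noteq> 0"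
    then have "f i \<noteq> 0" by auto
    moreover have "fls_subdegree a + fls_subdegree (f i) \<le> m"
      using m fls_times_nth_eq0[of m a "f i"] by force
    ultimately show "\<exists>m<n - fls_subdegree a. f i $$ m \<noteq> 0"
      using m by (intro exI[of _ "fls_subdegree (f i)"]) auto
  qed
  then show "finite {i. \<exists>m<n. (a * f i) $$ m \<noteq> 0}" using * finite_subset by blast
qed

lemma decaying_shift:
  assumes "decaying f"
  shows "decaying (\<lambda>i. f (i + c))"
  unfolding decaying_def
proof
  fix n
  have "{i. \<exists>m<n. f (i + c) $$ m \<noteq> 0} \<subseteq> (\<lambda>i. i - c) ` {i. \<exists>m<n. f i $$ m \<noteq> 0}"
    by (auto intro!: rev_image_eqI)
  then show "finite {i. \<exists>m<n. f (i + c) $$ m \<noteq> 0}"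
    using assms finite_surj unfolding decaying_def by blast
qed

lemma decaying_conv: "decaying f \<Longrightarrow> decaying (conv p f)"
proof (induction p)
  case 0
  then show ?case by (simp add: decaying_def)
next
  case (pCons a p)
  then have "decaying (\<lambda>i. a * f i + conv p f (i + - 1))"
    by (intro decaying_add decaying_scale decaying_shift)
  moreover have "conv (pCons a p) f = (\<lambda>i. a * f i + conv p f (i + - 1))"
    by (simp add: conv_pCons fun_eq_iff)
  ultimately show ?case by simp
qed

lemma decaying_diff: "decaying f \<Longrightarrow> decaying g \<Longrightarrow> decaying (\<lambda>i. f i - g i)"
  using decaying_add[of f "\<lambda>i. - 1 * g i"] decaying_scale[of g "- 1"] by simp

lemma decaying_subseq:
  assumes "decaying f" "\<And>i. g i = f i \<or> g i = 0"
  shows "decaying g"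
  unfolding decaying_def
proof
  fix n
  have "{i. \<exists>m<n. g i $$ m \<noteq> 0} \<subseteq> {i. \<exists>m<n. f i $$ m \<noteq> 0}" 
  proof clarify
    fix i m assume "m < n" "g i $$ m \<noteq> 0"
    moreover from this have "g i = f i" using assms(2)[of i] by auto
    ultimately show "\<exists>m<n. f i $$ m \<noteq> 0" by auto
  qed
  then show "finite {i. \<exists>m<n. g i $$ m \<noteq> 0}"
    using assms(1) finite_subset unfolding decaying_def by blast
qed

lemma decaying_delta: "decaying \<delta>"
  unfolding decaying_def
proof
  fix n
  have "{i. \<exists>m<n. (\<delta> i :: 'a fls) $$ m \<noteq> 0} \<subseteq> {0}" by (auto simp: \<delta>_def split: if_splits)
  then show "finite {i. \<exists>m<n. (\<delta> i :: 'a fls) $$ m \<noteq> 0}" using finite_subset by blast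
qed

text \<open>Only finitely many entries have terms below a given order, so a least order exists and
  is attained finitely often; the last index that attains it is the witness.\<close>

lemma decaying_min_subdegree:
  assumes "decaying h" "h i0 \<noteq> 0"
  shows "\<exists>i. h i \<noteq> 0 \<and> (\<forall>j. h j \<noteq> 0 \<longrightarrow> fls_subdegree (h i) \<le> fls_subdegree (h j)) \<and>
    (\<forall>j>i. h j \<noteq> 0 \<longrightarrow> fls_subdegree (h i) < fls_subdegree (h j))"
proof -
  define I where "I = (\<lambda>n. {i. h i \<noteq> 0 \<and> fls_subdegree (h i) \<le> n})"
  have fin: "finite (I n)" for n
  proof -
    have "I n \<subseteq> {i. \<exists>m<n + 1. h i $$ m \<noteq> 0}" unfolding I_def
    proof clarify
      fix i assume "h i \<noteq> 0" "fls_subdegree (h i) \<le> n"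
      then show "\<exists>m<n + 1. h i $$ m \<noteq> 0" by (intro exI[of _ "fls_subdegree (h i)"]) auto
    qed
    then show ?thesis using assms(1) finite_subset unfolding decaying_def by blast
  qed
  let ?n = "fls_subdegree (h i0)"
  define v where "v = Min ((\<lambda>i. fls_subdegree (h i)) ` I ?n)"
  have i0: "i0 \<in> I ?n" using assms by (simp add: I_def)
  have vmin: "v \<le> fls_subdegree (h j)" if "h j \<noteq> 0" for j
  proof (cases "j \<in> I ?n")
    case True
    then show ?thesis unfolding v_def using fin by (intro Min_le) auto
  next
    case False
    then have "?n < fls_subdegree (h j)" using that by (simp add: I_def)
    moreover have "v \<le> ?n" unfolding v_def using fin i0 by (intro Min_le) auto
    ultimately show ?thesis by simp
  qed
  have "v \<in> (\<lambda>i. fls_subdegree (h i)) ` I ?n" unfolding v_def using fin i0 by (intro Min_in) auto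
  then have ne: "I v \<noteq> {}" by (auto simp: I_def)
  define i where "i = Max (I v)"
  have "i \<in> I v" unfolding i_def using fin ne by (rule Max_in)
  then have i: "h i \<noteq> 0" "fls_subdegree (h i) = v" using vmin by (auto simp: I_def intro: antisym)
  have "fls_subdegree (h i) < fls_subdegree (h j)" if "j > i" "h j \<noteq> 0" for j
  proof -
    have "j \<notin> I v" using that fin[of v] Max_ge[of "I v" j] unfolding i_def by (meson not_less)
    then show ?thesis using that i by (simp add: I_def)
  qed
  then show ?thesis using i vmin by blast
qed

text \<open>As in Gauss's lemma: the product of the last terms of minimal order in \<^term>\<open>p\<close> and in
  \<^term>\<open>h\<close> cannot be cancelled.\<close>
lemma conv_decaying_eq_0:
  fixes h :: "int \<Rightarrow> 'a::field fls"
  assumes "decaying h" "p \<noteq> 0" "conv p h = (\<lambda>_. 0)"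
  shows "h = (\<lambda>_. 0)"
proof (rule ccontr)
  assume "h \<noteq> (\<lambda>_. 0)"
  then obtain i0 where "h i0 \<noteq> 0" by auto
  then obtain i where i: "h i \<noteq> 0" "\<And>j. h j \<noteq> 0 \<Longrightarrow> fls_subdegree (h i) \<le> fls_subdegree (h j)"
    "\<And>j. j > i \<Longrightarrow> h j \<noteq> 0 \<Longrightarrow> fls_subdegree (h i) < fls_subdegree (h j)"
    using decaying_min_subdegree[OF assms(1)] by blast
  \<comment> \<open>Read as a sequence, the polynomial is itself decaying, so its pivotal
    coefficient is found in the same way as that of \<open>h\<close>.\<close>
  define c where "c = conv p (\<delta> :: int \<Rightarrow> 'a fls)"
  have "decaying c" unfolding c_def by (intro decaying_conv decaying_delta)
  moreover have "c (int (degree p)) \<noteq> 0" unfolding c_def using assms(2) by (simp add: conv_delta)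
  ultimately obtain j where j: "c j \<noteq> 0" "\<And>l. c l \<noteq> 0 \<Longrightarrow> fls_subdegree (c j) \<le> fls_subdegree (c l)"
    "\<And>l. l > j \<Longrightarrow> c l \<noteq> 0 \<Longrightarrow> fls_subdegree (c j) < fls_subdegree (c l)"
    using decaying_min_subdegree by blast
  have cc: "coeff p l = c (int l)" for l unfolding c_def by (simp add: conv_delta)
  have "j \<ge> 0" using j(1) unfolding c_def by (auto simp: conv_delta split: if_splits)
  define j' where "j' = nat j"
  have j': "j = int j'" using \<open>j \<ge> 0\<close> by (simp add: j'_def)
  have "j' \<le> degree p" using j(1) unfolding j' cc[symmetric] by (rule le_degree)
  define v where "v = fls_subdegree (c j) + fls_subdegree (h i)"
  \<comment> \<open>For \<open>l < j'\<close> the factor from \<open>h\<close> lies beyond its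
    pivot, for \<open>l > j'\<close> the coefficient of \<open>p\<close> lies beyond its own; either
    way the order of the product exceeds \<open>v\<close>.\<close>
  have z: "(coeff p l * h (i + j - int l)) $$ v = 0" if "l \<noteq> j'" for l
  proof (cases "coeff p l = 0 \<or> h (i + j - int l) = 0")
    case False
    have "v < fls_subdegree (coeff p l) + fls_subdegree (h (i + j - int l))"
    proof (cases "l < j'")
      case True
      then have "i + j - int l > i" using j' by simp
      then show ?thesis unfolding v_def cc using False i(3) j(2)[of "int l"] by (fastforce simp: cc)
    next
      case ne: False
      then have "int l > j" using that j' by simp
      then show ?thesis unfolding v_def cc using False j(3)[of "int l"] i(2)[of "i + j - int l"] by (simp add: cc)
    qed
    then show ?thesis by (rule fls_times_nth_eq0)
  qed auto
  have "0 = conv p h (i + j) $$ v" using assms(3) by simp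
  also have "\<dots> = (\<Sum>l\<le>degree p. (coeff p l * h (i + j - int l)) $$ v)"
    unfolding conv_def by (simp add: fls_nth_sum)
  also have "\<dots> = (\<Sum>l\<in>{j'}. (coeff p l * h (i + j - int l)) $$ v)"
    using \<open>j' \<le> degree p\<close> z by (intro sum.mono_neutral_right) auto
  also have "\<dots> = (c j * h i) $$ (fls_subdegree (c j) + fls_subdegree (h i))"
    by (simp add: cc j' v_def)
  also have "\<dots> = c j $$ fls_subdegree (c j) * h i $$ fls_subdegree (h i)" by simp
  finally show False using i(1) j(1) by simp
qed


section \<open>Ideals of numerators and the nonnegative part of a rational function\<close>

text \<open>Division with remainder by an element of least degree. It is made monic because a scalar
  multiple of a divisor of a polynomial over \<open>k\<close> need not have algebraic
  coefficients.\<close>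

lemma ideal_generator:
  fixes J :: "'a::field poly set"
  assumes "\<And>p q. p \<in> J \<Longrightarrow> q \<in> J \<Longrightarrow> p + q \<in> J" "\<And>p q. p \<in> J \<Longrightarrow> q * p \<in> J" "P \<in> J" "P \<noteq> 0"
  shows "\<exists>V\<in>J. lead_coeff V = 1 \<and> (\<forall>Z\<in>J. V dvd Z)"
proof -
  obtain W where W: "W \<in> J" "W \<noteq> 0" "\<And>Z. Z \<in> J \<Longrightarrow> Z \<noteq> 0 \<Longrightarrow> degree W \<le> degree Z"
    using ex_has_least_nat[of "\<lambda>Z. Z \<in> J \<and> Z \<noteq> 0" P degree] assms(3,4) by blast
  define V where "V = smult (inverse (lead_coeff W)) W"
  have "V \<in> J" using assms(2)[OF W(1), of "[:inverse (lead_coeff W):]"] by (simp add: V_def)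
  moreover have "lead_coeff V = 1" using W(2) by (simp add: V_def)
  moreover have "V dvd Z" if "Z \<in> J" for Z
  proof -
    have "Z mod V = Z + (- (Z div V)) * V" by (simp add: minus_div_mult_eq_mod[symmetric])
    then have "Z mod V \<in> J" using assms(1,2) that \<open>V \<in> J\<close> by metis
    moreover have "degree V = degree W" using W(2) by (simp add: V_def)
    moreover have "V \<noteq> 0" using \<open>lead_coeff V = 1\<close> by auto
    ultimately have "Z mod V = 0" using W(3)[of "Z mod V"] degree_mod_less[of V Z] by fastforce
    then show ?thesis by (simp add: dvd_eq_mod_eq_0)
  qed
  ultimately show ?thesis by blast
qed

text \<open>This replaces the Wiener-Hopf factorisation of \<^term>\<open>p\<close> into small and large roots. The
  polynomials \<^term>\<open>Z\<close> such that \<^term>\<open>Z / p\<close> has a decaying expansion supported on the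
  nonnegative indices form an ideal with generator \<^term>\<open>V\<close>, and those for which it has one
  supported on a left half-line form an ideal with generator \<^term>\<open>U\<close>. Both generators divide
  \<^term>\<open>p\<close>, so their coefficients are algebraic, and by uniqueness of decaying expansions the two
  ideals meet in the multiples of \<^term>\<open>p\<close>.\<close>
lemma nonneg_part_algebraic:
  fixes k :: "'a::field fls set"
  assumes k: "subfield_set k"
    and p: "p \<noteq> 0" "\<And>i. coeff p i \<in> k" and n: "\<And>i. coeff n i \<in> k"
    and f: "decaying f" "conv p f = conv n \<delta>"
  shows "conv p (\<lambda>i. if i \<ge> 0 then f i else 0) i \<in> subfield_set.algs k"
proof -
  interpret K: subfield_set k by fact
  interpret A: subfield_set K.algs by (rule K.subfield_algs)
  define fp where "fp = (\<lambda>i. if i \<ge> 0 then f i else 0)"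
  define fm where "fm = (\<lambda>i. if i \<ge> 0 then 0 else f i)"
  have fpm: "f = (\<lambda>i. fp i + fm i)" by (auto simp: fp_def fm_def)
  have dec: "decaying fp" "decaying fm"
    by (rule decaying_subseq[OF f(1)]; auto simp: fp_def fm_def)+
  have split: "conv n \<delta> i = conv p fp i + conv p fm i" for i
    by (simp add: f(2)[symmetric], subst fpm, rule conv_add_right)
  have fp0: "conv p fp i = 0" if "i < 0" for i
    by (rule conv_eq_0_below[OF _ that]) (simp add: fp_def)
  have fm0: "conv p fm i = 0" if "i \<ge> int (degree p)" for i
    by (rule conv_eq_0_above[of "- 1"]) (use that in \<open>auto simp: fm_def\<close>)
  \<comment> \<open>To the left of 0 \<open>conv p fp\<close> vanishes; far to the right
    \<open>conv p fm\<close> and \<open>conv n \<delta>\<close> vanish and hence so does their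
    difference \<open>conv p fp\<close>. It is therefore a polynomial \<open>R\<close>, and the goal
    is that \<open>R\<close> has algebraic coefficients.\<close>
  define R where "R = (\<Sum>j\<le>degree p + degree n. monom (conv p fp (int j)) j)"
  have R: "conv p fp = conv R \<delta>" unfolding R_def
  proof (rule finite_support_conv_delta)
    fix i assume "i > int (degree p + degree n)"
    then show "conv p fp i = 0" using split[of i] fm0[of i] by (simp add: conv_delta coeff_eq_0)
  qed (rule fp0)
  have R': "conv p fm = conv (n - R) \<delta>"
    using split by (simp add: fun_eq_iff conv_diff R algebra_simps)

  define Jp where "Jp = {Z. \<exists>xs. decaying xs \<and> (\<forall>i<0. xs i = 0) \<and> conv p xs = conv Z \<delta>}"
  \<comment> \<open>The right end \<open>b\<close> is left free because multiplication by
    \<open>Q\<close> moves it by up to \<open>degree Q\<close>. The start 0 in \<open>Jp\<close> can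
    be fixed, since polynomials shift only to the right.\<close>
  define Jm where "Jm = {Z. \<exists>xs. decaying xs \<and> (\<exists>b. \<forall>i>b. xs i = 0) \<and> conv p xs = conv Z \<delta>}"
  have pJ: "p \<in> Jp" "p \<in> Jm" unfolding Jp_def Jm_def
    using decaying_delta by (auto intro!: exI[of _ \<delta>] exI[of _ 0] simp: \<delta>_def)
  have Jp_add: "Z + Z' \<in> Jp" if Z: "Z \<in> Jp" "Z' \<in> Jp" for Z Z'
  proof -
    obtain xs xs' where xs: "decaying xs" "\<forall>i<0. xs i = 0" "conv p xs = conv Z \<delta>"
      "decaying xs'" "\<forall>i<0. xs' i = 0" "conv p xs' = conv Z' \<delta>"
      using Z unfolding Jp_def by blast
    then show ?thesis unfolding Jp_def
      by (intro CollectI exI[of _ "\<lambda>i. xs i + xs' i"])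
        (auto simp: fun_eq_iff conv_add conv_add_right intro: decaying_add)
  qed
  have Jm_add: "Z + Z' \<in> Jm" if Z: "Z \<in> Jm" "Z' \<in> Jm" for Z Z'
  proof -
    obtain xs xs' b b' where xs: "decaying xs" "\<forall>i>b. xs i = 0" "conv p xs = conv Z \<delta>"
      "decaying xs'" "\<forall>i>b'. xs' i = 0" "conv p xs' = conv Z' \<delta>"
      using Z unfolding Jm_def by blast
    then show ?thesis unfolding Jm_def
      by (intro CollectI exI[of _ "\<lambda>i. xs i + xs' i"])
        (auto simp: fun_eq_iff conv_add conv_add_right intro!: decaying_add exI[of _ "max b b'"])
  qed
  have comm: "conv p (conv Q xs) = conv (Q * Z) \<delta>" if "conv p xs = conv Z \<delta>" for Q xs and Z :: "'a fls poly"
  proof -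
    have "conv p (conv Q xs) = conv (Q * p) xs" by (simp add: fun_eq_iff conv_mult[symmetric] mult.commute)
    also have "\<dots> = conv (Q * Z) \<delta>" by (simp add: fun_eq_iff conv_mult that)
    finally show ?thesis .
  qed
  have Jp_mult: "Q * Z \<in> Jp" if Z: "Z \<in> Jp" for Q Z
  proof -
    obtain xs where xs: "decaying xs" "\<forall>i<0. xs i = 0" "conv p xs = conv Z \<delta>"
      using Z unfolding Jp_def by blast
    then show ?thesis unfolding Jp_def
      by (intro CollectI exI[of _ "conv Q xs"]) (auto simp: comm intro: decaying_conv conv_eq_0_below)
  qed
  have Jm_mult: "Q * Z \<in> Jm" if Z: "Z \<in> Jm" for Q Z
  proof -
    obtain xs b where xs: "decaying xs" "\<forall>i>b. xs i = 0" "conv p xs = conv Z \<delta>"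
      using Z unfolding Jm_def by blast
    then have "\<forall>i>b + int (degree Q). conv Q xs i = 0" by (auto intro: conv_eq_0_above)
    then show ?thesis unfolding Jm_def using xs comm decaying_conv by blast
  qed
  have inter: "p dvd Z" if Z: "Z \<in> Jp" "Z \<in> Jm" for Z
  proof -
    obtain xs where xs: "decaying xs" "\<forall>i<0. xs i = 0" "conv p xs = conv Z \<delta>"
      using Z unfolding Jp_def by blast
    obtain ys b where ys: "decaying ys" "\<forall>i>b. ys i = 0" "conv p ys = conv Z \<delta>"
      using Z unfolding Jm_def by blast
    have "conv p (\<lambda>i. xs i - ys i) = (\<lambda>_. 0)" by (simp add: fun_eq_iff conv_diff_right xs ys)
    then have "(\<lambda>i. xs i - ys i) = (\<lambda>_. 0)"
      using conv_decaying_eq_0[OF decaying_diff[OF xs(1) ys(1)] p(1)] by blast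
    \<comment> \<open>The common expansion is bounded on both sides, hence a polynomial, and this is
      the cofactor of \<open>p\<close>.\<close>
    then have "xs i = ys i" for i by (metis eq_iff_diff_eq_0)
    then have "\<And>i. i > int (nat b) \<Longrightarrow> xs i = 0" using ys(2) by (auto split: if_splits)
    then obtain x where x: "xs = conv x \<delta>" using finite_support_conv_delta xs(2) by blast
    have "conv (p * x) \<delta> = conv Z \<delta>" using xs(3) x by (simp add: fun_eq_iff conv_mult)
    then show ?thesis using conv_delta_inject by (metis dvd_triv_left)
  qed

  obtain V where V: "V \<in> Jp" "lead_coeff V = 1" "\<And>Z. Z \<in> Jp \<Longrightarrow> V dvd Z"
    using ideal_generator[of Jp p] Jp_add Jp_mult pJ p(1) by metis
  obtain U where U: "U \<in> Jm" "lead_coeff U = 1" "\<And>Z. Z \<in> Jm \<Longrightarrow> U dvd Z"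
    using ideal_generator[of Jm p] Jm_add Jm_mult pJ p(1) by metis
  have VA: "V \<in> A.polys" and UA: "U \<in> A.polys"
    using K.coeff_monic_dvd_mem_algs[OF p(2,1)] V U pJ by (auto simp: A.polys_def)
  have nA: "n \<in> A.polys" and pA: "p \<in> A.polys"
    using n p K.mem_algs by (auto simp: A.polys_def)
  have "\<forall>i<0. fp i = 0" "\<forall>i>0. fm i = 0" by (auto simp: fp_def fm_def)
  then have RJ: "R \<in> Jp" "n - R \<in> Jm" unfolding Jp_def Jm_def using R R' dec by blast+
  \<comment> \<open>These cofactors are arbitrary polynomials over the Laurent series. The descent
    makes them algebraic, at the price that \<open>V * a'\<close> agrees with \<open>R\<close> only
    modulo \<open>p\<close>.\<close>
  then obtain a b where "R = V * a" "n - R = U * b" using V(3) U(3) by (meson dvdE)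
  then have "n = V * a + U * b" by (metis add.commute diff_add_cancel)
  then obtain a' b' where ab: "a' \<in> A.polys" "b' \<in> A.polys" "n = V * a' + U * b'"
    using A.polys_bezout_descent[OF VA UA nA] by blast
  have "R - V * a' = R + (- a') * V" by simp
  then have "R - V * a' \<in> Jp" using RJ(1) Jp_add Jp_mult V(1) by metis
  moreover have "R - V * a' = b' * U + (- 1) * (n - R)" unfolding ab(3) by (simp add: algebra_simps)
  then have "R - V * a' \<in> Jm" using RJ(2) Jm_add Jm_mult U(1) by metis
  ultimately have d: "p dvd R - V * a'" by (rule inter)

  \<comment> \<open>From \<open>degree p\<close> on the coefficients of \<open>R\<close> are those
    of \<open>n\<close>, because \<open>fm\<close> contributes nothing there. Without this part
    \<open>T\<close>, what is left of \<open>R\<close> is a reduced remainder modulo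
    \<open>p\<close>, which the congruence determines.\<close>
  define T where "T = (\<Sum>j\<in>{degree p..degree n}. monom (coeff n j) j)"
  have cT: "coeff T j = (if j \<ge> degree p then coeff n j else 0)" for j
    unfolding T_def by (auto simp: coeff_sum coeff_eq_0)
  have TA: "T \<in> A.polys" using nA by (auto simp: A.polys_def cT)
  have "coeff R j = coeff T j" if "j \<ge> degree p" for j
    using split[of "int j"] fm0[of "int j"] that by (simp add: R conv_delta cT)
  then have RT: "R - T = 0 \<or> degree (R - T) < degree p"
    by (metis (no_types, lifting) coeff_diff diff_self leading_coeff_0_iff linorder_not_less)
  have "R - T = (V * a' - T) mod p"
  proof -
    have "(R - T) mod p = (V * a' - T) mod p"
      using d by (simp add: mod_eq_dvd_iff)
    moreover have "(R - T) mod p = R - T" using RT by (metis mod_poly_less mod_0)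
    ultimately show ?thesis by simp
  qed
  also have "\<dots> \<in> A.polys"
    using A.polys_div_mod[OF A.polys_diff[OF A.polys_mult[OF VA ab(1)] TA] pA] by blast
  finally have "R \<in> A.polys" using A.polys_add[OF _ TA] by (metis diff_add_cancel)
  then show ?thesis using R by (auto simp: fp_def[symmetric] conv_delta A.polys_def)
qed

section \<open>Summation over all levels\<close>

text \<open>The substitution u = 1 in a bilateral series. \<open>Sum_any\<close> is meaningful under
  \<open>summable_seq\<close>, which leaves finitely many levels for each power of t.\<close>

definition tot :: "(int \<Rightarrow> 'a::comm_ring_1 fps) \<Rightarrow> 'a fps" where
  "tot g = Abs_fps (\<lambda>n. Sum_any (\<lambda>i. g i $ n))"

definition summable_seq :: "(int \<Rightarrow> 'a::comm_ring_1 fps) \<Rightarrow> bool" where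
  "summable_seq g \<longleftrightarrow> (\<forall>n. finite {i. g i $ n \<noteq> 0})"

lemma summable_seq_add: "summable_seq f \<Longrightarrow> summable_seq g \<Longrightarrow> summable_seq (\<lambda>i. f i + g i)"
  unfolding summable_seq_def
proof
  fix n
  assume "\<forall>n. finite {i. f i $ n \<noteq> 0}" "\<forall>n. finite {i. g i $ n \<noteq> 0}"
  then have "finite ({i. f i $ n \<noteq> 0} \<union> {i. g i $ n \<noteq> 0})" by simp
  then show "finite {i. (f i + g i) $ n \<noteq> 0}" by (rule rev_finite_subset) auto
qed

lemma tot_add:
  assumes "summable_seq f" "summable_seq g"
  shows "tot (\<lambda>i. f i + g i) = tot f + tot g"
  using assms unfolding tot_def summable_seq_def
  by (intro fps_ext) (simp add: Sum_any.distrib)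

lemma summable_seq_shift: "summable_seq g \<Longrightarrow> summable_seq (\<lambda>i. g (i + c))"
  unfolding summable_seq_def
proof
  fix n
  assume "\<forall>n. finite {i. g i $ n \<noteq> 0}"
  moreover have "{i. g (i + c) $ n \<noteq> 0} \<subseteq> (\<lambda>i. i - c) ` {i. g i $ n \<noteq> 0}"
    by (auto intro!: rev_image_eqI)
  ultimately show "finite {i. g (i + c) $ n \<noteq> 0}" using finite_surj by blast
qed

lemma tot_shift: "tot (\<lambda>i. g (i + c)) = tot g"
proof -
  have "bij (\<lambda>i. i + c)" for c :: int by (rule bijI) (auto simp: inj_def intro: surjI[of _ "\<lambda>i. i - c"])
  then show ?thesis unfolding tot_def
    by (intro fps_ext) (auto intro!: Sum_any.reindex_cong[of "\<lambda>i. i + c", symmetric] simp: bij_def fun_eq_iff)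
qed

lemma
  fixes a :: "'a::comm_ring_1 fps"
  assumes "summable_seq g"
  shows summable_seq_scale: "summable_seq (\<lambda>i. a * g i)"
    and tot_scale: "tot (\<lambda>i. a * g i) = a * tot g"
proof -
  define B where "B = (\<lambda>n. \<Union>m\<le>n. {i. g i $ m \<noteq> 0})"
  have B: "finite (B n)" for n using assms by (auto simp: B_def summable_seq_def)
  have sub: "{i. (a * g i) $ n \<noteq> 0} \<subseteq> B n" for n
  proof clarify
    fix i assume *: "(a * g i) $ n \<noteq> 0"
    show "i \<in> B n"
    proof (rule ccontr)
      assume "i \<notin> B n"
      then have "(a * g i) $ n = 0" unfolding fps_mult_nth B_def by (intro sum.neutral) auto
      then show False using * by simp
    qed
  qed
  show "summable_seq (\<lambda>i. a * g i)"
    using B sub unfolding summable_seq_def by (blast intro: finite_subset)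
  show "tot (\<lambda>i. a * g i) = a * tot g"
  proof (rule fps_ext)
    fix n
    have 1: "Sum_any (\<lambda>i. g i $ m) = (\<Sum>i\<in>B n. g i $ m)" if "m \<le> n" for m
      using that B by (intro Sum_any.expand_superset) (auto simp: B_def)
    have "tot (\<lambda>i. a * g i) $ n = (\<Sum>i\<in>B n. (a * g i) $ n)"
      unfolding tot_def using B sub by (simp add: Sum_any.expand_superset)
    also have "\<dots> = (\<Sum>m=0..n. a $ m * (\<Sum>i\<in>B n. g i $ (n - m)))"
      by (simp add: fps_mult_nth sum_distrib_left sum.swap[of _ "B n"])
    also have "\<dots> = (a * tot g) $ n" unfolding fps_mult_nth tot_def by (simp add: 1)
    finally show "tot (\<lambda>i. a * g i) $ n = (a * tot g) $ n" .
  qed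
qed

text \<open>A shift of the levels does not change the total, so the catalytic variable acts on
  totals as the number 1.\<close>

lemma conv_summable:
  assumes "summable_seq g"
  shows "summable_seq (conv p g) \<and> tot (conv p g) = poly p 1 * tot g"
proof (induction p)
  case 0
  then show ?case by (simp add: summable_seq_def tot_def fps_ext)
next
  case (pCons a p)
  have e: "conv (pCons a p) g = (\<lambda>i. a * g i + conv p g (i + - 1))" by (simp add: conv_pCons fun_eq_iff)
  show ?case unfolding e using assms pCons
    by (simp only: summable_seq_add summable_seq_scale summable_seq_shift tot_add tot_scale tot_shift)
      (simp add: algebra_simps)
qed

lemma conv_fps_to_fls:
  "conv (map_poly fps_to_fls p) (\<lambda>i. fps_to_fls (g i)) i = fps_to_fls (conv p g i)"
  by (induction p arbitrary: i) (simp_all add: map_poly_pCons conv_pCons fls_times_fps_to_fls)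

lemma fps_to_fls_sum: "fps_to_fls (sum f A) = (\<Sum>x\<in>A. fps_to_fls (f x))"
  by (induction A rule: infinite_finite_induct) auto

text \<open>Multiplied by \<open>p\<close>, the nonnegative part is a polynomial in u with algebraic
  coefficients. Its value at u = 1 is \<open>poly p 1\<close> times the desired sum, and the nonzero
  factor is divided out in the field of Laurent series.\<close>

lemma nonneg_sum_algebraic:
  fixes k :: "'a::field fls set" and p n :: "'a fps poly"
  assumes k: "subfield_set k"
    and p: "poly p 1 \<noteq> 0" "\<And>i. fps_to_fls (coeff p i) \<in> k"
    and n: "\<And>i. fps_to_fls (coeff n i) \<in> k"
    and g: "summable_seq g" "conv p g = conv n \<delta>"
  shows "fps_to_fls (tot (\<lambda>i. if i \<ge> 0 then g i else 0)) \<in> subfield_set.algs k"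
proof -
  interpret K: subfield_set k by fact
  interpret A: subfield_set K.algs by (rule K.subfield_algs)
  define gp where "gp = (\<lambda>i. if i \<ge> 0 then g i else 0)"
  define gm where "gm = (\<lambda>i. if i \<ge> 0 then 0 else g i)"
  have gpm: "g = (\<lambda>i. gp i + gm i)" by (auto simp: gp_def gm_def)
  have split: "conv n \<delta> i = conv p gp i + conv p gm i" for i
    by (simp add: g(2)[symmetric], subst gpm, rule conv_add_right)
  have "{i. gp i $ m \<noteq> 0} \<subseteq> {i. g i $ m \<noteq> 0}" for m by (auto simp: gp_def)
  then have sgp: "summable_seq gp" using g(1) finite_subset unfolding summable_seq_def by blast
  let ?I = "{0..int (degree p + degree n)}"
  have supp: "conv p gp i = 0" if "i \<notin> ?I" for i
  proof (cases "i < 0")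
    case True
    then show ?thesis by (intro conv_eq_0_below[of 0]) (auto simp: gp_def)
  next
    case False
    then have "conv p gm i = 0" using that
      by (intro conv_eq_0_above[of "- 1"]) (auto simp: gm_def)
    then show ?thesis using split[of i] that False by (simp add: conv_delta coeff_eq_0)
  qed
  have "fps_to_fls (conv p gp i) \<in> K.algs" for i
  proof -
    have "decaying (\<lambda>i. fps_to_fls (g i))" unfolding decaying_def
    proof
      fix N
      have "{i. \<exists>m<N. fps_to_fls (g i) $$ m \<noteq> 0} \<subseteq> (\<Union>m<nat N. {i. g i $ m \<noteq> 0})"
        by (force split: if_splits)
      moreover have "finite (\<Union>m<nat N. {i. g i $ m \<noteq> 0})" using g(1) by (simp add: summable_seq_def)
      ultimately show "finite {i. \<exists>m<N. fps_to_fls (g i) $$ m \<noteq> 0}" by (rule finite_subset)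
    qed
    moreover have "conv (map_poly fps_to_fls p) (\<lambda>i. fps_to_fls (g i)) = conv (map_poly fps_to_fls n) \<delta>"
    proof -
      have "(\<lambda>i. fps_to_fls (\<delta> i)) = (\<delta> :: int \<Rightarrow> 'a fls)" by (auto simp: \<delta>_def)
      then show ?thesis
        using conv_fps_to_fls[of n \<delta>] by (simp add: fun_eq_iff conv_fps_to_fls g(2))
    qed
    moreover have "map_poly fps_to_fls p \<noteq> 0"
    proof
      assume "map_poly fps_to_fls p = 0"
      then have "coeff p i = 0" for i by (metis coeff_0 coeff_map_poly fps_to_fls_eq_0_iff fps_zero_to_fls)
      then have "p = 0" by (simp add: poly_eq_iff)
      then show False using p(1) by simp
    qed
    ultimately have "conv (map_poly fps_to_fls p) (\<lambda>i. if i \<ge> 0 then fps_to_fls (g i) else 0) i \<in> K.algs"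
      using k p(2) n by (intro nonneg_part_algebraic[where n = "map_poly fps_to_fls n"]) (auto simp: coeff_map_poly)
    moreover have "(\<lambda>i. if i \<ge> 0 then fps_to_fls (g i) else 0) = (\<lambda>i. fps_to_fls (gp i))"
      by (auto simp: gp_def)
    ultimately show ?thesis by (simp add: conv_fps_to_fls)
  qed
  then have "fps_to_fls (\<Sum>i\<in>?I. conv p gp i) \<in> K.algs"
    unfolding fps_to_fls_sum by (rule A.sum_mem)
  moreover have "(\<Sum>i\<in>?I. conv p gp i) = poly p 1 * tot gp"
  proof -
    have "tot (conv p gp) = (\<Sum>i\<in>?I. conv p gp i)"
      unfolding tot_def
    proof (rule fps_ext)
      fix m
      have "{i. conv p gp i $ m \<noteq> 0} \<subseteq> ?I" using supp by fastforce
      then show "Abs_fps (\<lambda>m. Sum_any (\<lambda>i. conv p gp i $ m)) $ m = (\<Sum>i\<in>?I. conv p gp i) $ m"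
        by (simp add: Sum_any.expand_superset[of ?I] fps_sum_nth)
    qed
    then show ?thesis using conv_summable[OF sgp] by metis
  qed
  moreover have "fps_to_fls (poly p 1) \<in> K.algs"
    unfolding poly_altdef using p(2) K.mem_algs by (simp add: fps_to_fls_sum A.sum_mem)
  ultimately have "fps_to_fls (poly p 1 * tot gp) / fps_to_fls (poly p 1) \<in> K.algs"
    using A.divide_mem by metis
  then show ?thesis using p(1) by (simp add: fls_times_fps_to_fls gp_def)
qed

section \<open>Words read by a finite automaton\<close>

lemma map_poly_fps_of_poly_mult:
  "map_poly fps_of_poly (p * q) = map_poly fps_of_poly p * map_poly fps_of_poly q"
  by (rule poly_eqI) (simp add: coeff_map_poly coeff_mult fps_of_poly_sum fps_of_poly_mult)

lemma map_poly_fps_of_poly_diff: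
  "map_poly fps_of_poly (p - q) = map_poly fps_of_poly p - map_poly fps_of_poly q"
  by (rule poly_eqI) (simp add: coeff_map_poly fps_of_poly_diff)

lemma map_poly_fps_of_poly_sum:
  "map_poly fps_of_poly (sum f A) = (\<Sum>x\<in>A. map_poly fps_of_poly (f x))"
  by (rule poly_eqI) (simp add: coeff_map_poly coeff_sum fps_of_poly_sum)

lemma poly_map_poly_fps_of_poly: "poly (map_poly fps_of_poly p) 1 = fps_of_poly (poly p 1)"
  by (induction p) (simp_all add: map_poly_pCons fps_of_poly_add)

context
  fixes S :: "'b set" and N :: nat and h :: "'b list \<Rightarrow> nat" and \<tau> :: "nat \<Rightarrow> 'b \<Rightarrow> nat"
    and \<alpha> :: "'b \<Rightarrow> 'a::field" and e :: "'b \<Rightarrow> int"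
  assumes S: "finite S"
    and h: "\<And>w. set w \<subseteq> S \<Longrightarrow> h w < N"
    and \<tau>: "\<And>w s. set w \<subseteq> S \<Longrightarrow> s \<in> S \<Longrightarrow> h (w @ [s]) = \<tau> (h w) s"
begin

definition level_words :: "nat \<Rightarrow> nat \<Rightarrow> int \<Rightarrow> 'b list set" where
  "level_words n q i = {w. set w \<subseteq> S \<and> length w = n \<and> h w = q \<and> sum_list (map e w) = i}"

text \<open>The level is an index and not the exponent of a further variable, so that for fixed
  \<open>q\<close> the family over \<open>i\<close> is a bilateral sequence on which
  \<open>conv\<close> acts.\<close>

definition level_gf :: "nat \<Rightarrow> int \<Rightarrow> 'a fps" where
  "level_gf q i = Abs_fps (\<lambda>n. \<Sum>w\<in>level_words n q i. prod_list (map \<alpha> w))"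

lemma level_gf_nth_0: "level_gf q i $ 0 = (if q = h [] \<and> i = 0 then 1 else 0)"
proof -
  have "level_words 0 q i = (if q = h [] \<and> i = 0 then {[]} else {})" by (auto simp: level_words_def)
  then show ?thesis by (simp add: level_gf_def)
qed

text \<open>Deleting the last letter is a bijection; the shorter words are then grouped by the state
  in which that letter is read.\<close>

lemma level_gf_nth_Suc:
  "level_gf q i $ Suc n = (\<Sum>s\<in>S. \<Sum>q'\<in>{q'. q' < N \<and> \<tau> q' s = q}. \<alpha> s * level_gf q' (i - e s) $ n)"
proof -
  define L where "L = (\<lambda>s. {w. set w \<subseteq> S \<and> length w = n \<and> \<tau> (h w) s = q \<and> sum_list (map e w) = i - e s})"
  have fL: "finite (L s)" for s
    by (rule finite_subset[OF _ finite_lists_length_eq[OF S, of n]]) (auto simp: L_def)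
  have "level_gf q i $ Suc n = (\<Sum>(s, w)\<in>Sigma S L. \<alpha> s * prod_list (map \<alpha> w))"
    unfolding level_gf_def fps_nth_Abs_fps
  proof (rule sum.reindex_bij_witness[where i = "\<lambda>(s, w). w @ [s]" and j = "\<lambda>w. (last w, butlast w)"])
    fix w assume w: "w \<in> level_words (Suc n) q i"
    then have "w \<noteq> []" by (auto simp: level_words_def)
    then obtain v s where v: "w = v @ [s]" by (metis append_butlast_last_id)
    then show "(case (last w, butlast w) of (s, w) \<Rightarrow> w @ [s]) = w"
      "(last w, butlast w) \<in> Sigma S L"
      "(case (last w, butlast w) of (s, w) \<Rightarrow> \<alpha> s * prod_list (map \<alpha> w)) = prod_list (map \<alpha> w)"
      using w \<tau>[of v s] by (auto simp: level_words_def L_def mult.commute)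
  next
    fix b assume "b \<in> Sigma S L"
    then show "(last (case b of (s, w) \<Rightarrow> w @ [s]), butlast (case b of (s, w) \<Rightarrow> w @ [s])) = b"
      "(case b of (s, w) \<Rightarrow> w @ [s]) \<in> level_words (Suc n) q i"
      using \<tau> by (auto simp: level_words_def L_def)
  qed
  also have "\<dots> = (\<Sum>s\<in>S. \<Sum>w\<in>L s. \<alpha> s * prod_list (map \<alpha> w))"
    using S fL by (subst sum.Sigma) auto
  also have "\<dots> = (\<Sum>s\<in>S. \<Sum>q'\<in>{q'. q' < N \<and> \<tau> q' s = q}. \<alpha> s * level_gf q' (i - e s) $ n)"
  proof (rule sum.cong[OF refl])
    fix s assume "s \<in> S"
    let ?Q = "{q'. q' < N \<and> \<tau> q' s = q}"
    have "(\<Sum>w\<in>L s. \<alpha> s * prod_list (map \<alpha> w))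
        = (\<Sum>q'\<in>?Q. \<Sum>w\<in>{w \<in> L s. h w = q'}. \<alpha> s * prod_list (map \<alpha> w))"
      using fL h by (intro sum.group[symmetric]) (auto simp: L_def)
    also have "\<dots> = (\<Sum>q'\<in>?Q. \<alpha> s * level_gf q' (i - e s) $ n)"
    proof (rule sum.cong[OF refl])
      fix q' assume "q' \<in> ?Q"
      then have "{w \<in> L s. h w = q'} = level_words n q' (i - e s)"
        by (auto simp: L_def level_words_def)
      then show "(\<Sum>w\<in>{w \<in> L s. h w = q'}. \<alpha> s * prod_list (map \<alpha> w)) = \<alpha> s * level_gf q' (i - e s) $ n"
        by (simp add: level_gf_def sum_distrib_left)
    qed
    finally show "(\<Sum>w\<in>L s. \<alpha> s * prod_list (map \<alpha> w)) = (\<Sum>q'\<in>?Q. \<alpha> s * level_gf q' (i - e s) $ n)" .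
  qed
  finally show ?thesis .
qed

lemma level_gf_rec:
  "level_gf q i = (if q = h [] \<and> i = 0 then 1 else 0) +
    (\<Sum>q'<N. \<Sum>s\<in>{s\<in>S. \<tau> q' s = q}. fps_const (\<alpha> s) * fps_X * level_gf q' (i - e s))"
proof (rule fps_ext)
  fix n
  show "level_gf q i $ n = ((if q = h [] \<and> i = 0 then 1 else 0) +
    (\<Sum>q'<N. \<Sum>s\<in>{s\<in>S. \<tau> q' s = q}. fps_const (\<alpha> s) * fps_X * level_gf q' (i - e s))) $ n"
  proof (cases n)
    case 0
    then show ?thesis by (simp add: level_gf_nth_0 fps_sum_nth)
  next
    case (Suc m)
    have "(\<Sum>s\<in>S. \<Sum>q'\<in>{q'. q' < N \<and> \<tau> q' s = q}. \<alpha> s * level_gf q' (i - e s) $ m)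
      = (\<Sum>q'<N. \<Sum>s\<in>{s\<in>S. \<tau> q' s = q}. \<alpha> s * level_gf q' (i - e s) $ m)"
      using sum.swap_restrict[OF S finite_lessThan[of N],
        of "\<lambda>s q'. \<alpha> s * level_gf q' (i - e s) $ m" "\<lambda>s q'. \<tau> q' s = q"] by simp
    then show ?thesis using Suc by (simp add: level_gf_nth_Suc fps_sum_nth mult.assoc)
  qed
qed

lemma bounded_level:
  assumes "\<And>s. s \<in> S \<Longrightarrow> \<bar>e s\<bar> \<le> int d" "level_gf q i $ n \<noteq> 0"
  shows "\<bar>i\<bar> \<le> int (n * d)"
proof -
  have "\<bar>sum_list (map e w)\<bar> \<le> int (length w * d)" if "set w \<subseteq> S" for w
    using that by (induction w) (use assms(1) in \<open>fastforce simp: abs_le_iff\<close>)+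
  moreover obtain w where "w \<in> level_words n q i"
    using assms(2) unfolding level_gf_def by (auto elim: sum.not_neutral_contains_not_neutral)
  ultimately show ?thesis by (auto simp: level_words_def)
qed

text \<open>The level series of all states solve a linear system with matrix u^d (1 - t T(u)), where
  T is the transition matrix with levels marked by u. Multiplication by the adjugate isolates one
  state and makes the determinant its kernel; inverting the matrix would not make sense on bilateral
  series.\<close>

lemma automaton_gf_algebraic:
  fixes k :: "'a fls set"
  assumes k: "subfield_set k" "\<And>a. fls_const a \<in> k" "fls_X \<in> k" and q: "q < N"
  shows "fps_to_fls (Abs_fps (\<lambda>n. \<Sum>w\<in>{w. set w \<subseteq> S \<and> length w = n \<and> h w = q \<and> c \<le> sum_list (map e w)}.
    prod_list (map \<alpha> w))) \<in> subfield_set.algs k"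
proof -
  interpret K: subfield_set k by fact
  have polyk: "fps_to_fls (fps_of_poly p) \<in> k" for p :: "'a poly"
  proof (induction p)
    case (pCons a p)
    then show ?case
      by (simp add: fps_of_poly_pCons fls_times_fps_to_fls K.add_mem K.mult_mem k)
  qed simp
  \<comment> \<open>The bound includes \<open>c\<close> because both \<open>d + e s\<close> and
    \<open>d - c\<close> have to be nonnegative exponents, the latter for the shift of levels by
    \<open>c\<close>.\<close>
  define E where "E = Max (insert \<bar>c\<bar> ((\<lambda>s. \<bar>e s\<bar>) ` S))"
  have "finite (insert \<bar>c\<bar> ((\<lambda>s. \<bar>e s\<bar>) ` S))" using S by simp
  then have E: "\<bar>c\<bar> \<le> E" "\<And>s. s \<in> S \<Longrightarrow> \<bar>e s\<bar> \<le> E"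
    unfolding E_def by (auto intro!: Max_ge)
  define d where "d = nat E"
  have d: "\<bar>c\<bar> \<le> int d" "\<And>s. s \<in> S \<Longrightarrow> \<bar>e s\<bar> \<le> int d"
    using E by (auto simp: d_def)

  \<comment> \<open>The inner polynomial variable is t and the outer one is u; rows are target
    states and columns are source states. The factor u^d clears negative exponents.\<close>
  define a :: "nat \<Rightarrow> nat \<Rightarrow> 'a poly poly" where
    "a = (\<lambda>r q'. (if r = q' then monom 1 d else 0) -
      (\<Sum>s\<in>{s\<in>S. \<tau> q' s = r}. monom (monom (\<alpha> s) 1) (nat (int d + e s))))"
  define A where "A = mat N N (\<lambda>(r, q'). a r q')"
  define D where "D = Determinant.det A"
  define b where "b = (\<lambda>r q'. adj_mat A $$ (r, q'))"
  have A: "A \<in> carrier_mat N N" by (simp add: A_def)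
  let ?H = "map_poly fps_of_poly :: 'a poly poly \<Rightarrow> 'a fps poly"
  have conv_a: "conv (?H (a r q')) f i = (if r = q' then f (i - int d) else 0) -
      (\<Sum>s\<in>{s\<in>S. \<tau> q' s = r}. fps_const (\<alpha> s) * fps_X * f (i - int d - e s))" for r q' f i
  proof -
    have "f (i - int (nat (int d + e s))) = f (i - int d - e s)" if "s \<in> S" for s
      using d(2)[OF that] by (intro arg_cong[of _ _ f]) simp
    then show ?thesis unfolding a_def
      by (auto simp: map_poly_fps_of_poly_diff map_poly_fps_of_poly_sum conv_diff conv_sum_left
        map_poly_monom conv_monom fps_of_poly_monom simp del: int_nat_eq intro!: sum.cong)
  qed
  have sys: "(\<Sum>q'<N. conv (?H (a r q')) (level_gf q') i) = conv (if r = h [] then monom 1 d else 0) \<delta> i"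
    if "r < N" for r i
  proof -
    have "(\<Sum>q'<N. conv (?H (a r q')) (level_gf q') i) = level_gf r (i - int d) -
        (\<Sum>q'<N. \<Sum>s\<in>{s\<in>S. \<tau> q' s = r}. fps_const (\<alpha> s) * fps_X * level_gf q' (i - int d - e s))"
      using that by (simp add: conv_a sum_subtractf sum.delta)
    also have "\<dots> = (if r = h [] \<and> i - int d = 0 then 1 else 0)"
      by (subst level_gf_rec) simp
    finally show ?thesis by (simp add: conv_monom \<delta>_def)
  qed
  have adj: "(\<Sum>r<N. b q r * a r q') = (if q = q' then D else 0)" if "q' < N" for q'
  proof -
    have "(\<Sum>r<N. b q r * a r q') = (adj_mat A * A) $$ (q, q')"
      using adj_mat(1)[OF A] A q that
      by (simp add: times_mat_def scalar_prod_def b_def A_def atLeast0LessThan)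
    then show ?thesis using adj_mat(3)[OF A] q that by (simp add: D_def)
  qed
  have D: "conv (?H D) (level_gf q) = conv (?H (b q (h [])) * monom 1 d) \<delta>"
  proof
    fix i
    have "conv (?H D) (level_gf q) i = (\<Sum>q'<N. conv (?H (\<Sum>r<N. b q r * a r q')) (level_gf q') i)"
      using q by (simp add: adj if_distrib if_distribR sum.delta cong: if_cong)
    also have "\<dots> = (\<Sum>q'<N. \<Sum>r<N. conv (?H (b q r)) (conv (?H (a r q')) (level_gf q')) i)"
      by (simp add: map_poly_fps_of_poly_sum map_poly_fps_of_poly_mult conv_sum_left conv_mult)
    also have "\<dots> = (\<Sum>r<N. \<Sum>q'<N. conv (?H (b q r)) (conv (?H (a r q')) (level_gf q')) i)"
      by (rule sum.swap)
    also have "\<dots> = (\<Sum>r<N. conv (?H (b q r)) (\<lambda>i. \<Sum>q'<N. conv (?H (a r q')) (level_gf q') i) i)"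
      by (simp add: conv_sum_right)
    also have "\<dots> = (\<Sum>r<N. conv (?H (b q r)) (conv (if r = h [] then monom 1 d else 0) \<delta>) i)"
      by (rule sum.cong) (simp_all add: sys)
    also have "\<dots> = (\<Sum>r<N. if r = h [] then conv (?H (b q r)) (conv (monom 1 d) \<delta>) i else 0)"
      by (rule sum.cong) auto
    also have "\<dots> = conv (?H (b q (h [])) * monom 1 d) \<delta> i"
      using h[of "[]"] by (simp add: sum.delta conv_mult)
    finally show "conv (?H D) (level_gf q) i = conv (?H (b q (h [])) * monom 1 d) \<delta> i" .
  qed
  \<comment> \<open>At u = 1 and t = 0 the matrix becomes the identity, so the determinant becomes
    1.\<close>
  have nz: "poly (?H D) 1 \<noteq> 0"
  proof -
    interpret ev: comm_ring_hom "\<lambda>p :: 'a poly poly. poly (poly p 1) 0"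
      by unfold_locales auto
    have "map_mat (\<lambda>p :: 'a poly poly. poly (poly p 1) 0) A = 1\<^sub>m N"
      by (rule eq_matI) (auto simp: A_def a_def poly_sum poly_monom)
    then have "poly (poly D 1) 0 = (1 :: 'a)"
      using ev.hom_det[of A] by (simp add: D_def)
    then have "poly D 1 \<noteq> 0" by auto
    then show ?thesis by (simp add: poly_map_poly_fps_of_poly fps_of_poly_eq_iff[of _ 0, simplified])
  qed

  \<comment> \<open>The shift by \<open>c\<close> turns the bound by \<open>c\<close> into
    nonnegativity.\<close>
  define g where "g = (\<lambda>i. level_gf q (i + c))"
  define n where "n = ?H (b q (h [])) * monom 1 (nat (int d - c))"
  have "conv (?H D) g = conv n \<delta>"
  proof
    fix i
    have "conv (?H D) g i = conv (?H (b q (h []))) (conv (monom 1 d) \<delta>) (i + c)"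
      unfolding g_def by (simp add: conv_shift D conv_mult)
    also have "\<dots> = conv (?H (b q (h []))) (\<lambda>i. conv (monom 1 d) \<delta> (i + c)) i"
      by (simp add: conv_shift)
    also have "(\<lambda>i. conv (monom 1 d) \<delta> (i + c)) = (conv (monom 1 (nat (int d - c))) \<delta> :: int \<Rightarrow> 'a fps)"
      using d(1) by (auto simp: conv_monom fun_eq_iff algebra_simps)
    finally show "conv (?H D) g i = conv n \<delta> i" by (simp add: n_def conv_mult)
  qed
  moreover have sg: "summable_seq g" unfolding summable_seq_def
  proof
    fix m
    have "{i. g i $ m \<noteq> 0} \<subseteq> {- int (m * d) - c..int (m * d) - c}"
      using bounded_level[OF d(2), of q _ m] by (force simp: g_def abs_le_iff)
    then show "finite {i. g i $ m \<noteq> 0}" using finite_subset by blast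
  qed
  moreover have "fps_to_fls (coeff n i) \<in> k" for i
    unfolding n_def by (subst mult.commute) (simp add: coeff_monom_mult coeff_map_poly polyk)
  ultimately have "fps_to_fls (tot (\<lambda>i. if i \<ge> 0 then g i else 0)) \<in> K.algs"
    using nz k(1) by (intro nonneg_sum_algebraic[of k "?H D" n g]) (auto simp: coeff_map_poly polyk)
  moreover have "tot (\<lambda>i. if i \<ge> 0 then g i else 0) =
      Abs_fps (\<lambda>n. \<Sum>w\<in>{w. set w \<subseteq> S \<and> length w = n \<and> h w = q \<and> c \<le> sum_list (map e w)}. prod_list (map \<alpha> w))"
    unfolding tot_def
  proof (rule fps_ext, unfold fps_nth_Abs_fps)
    fix m
    let ?W = "{w. set w \<subseteq> S \<and> length w = m \<and> h w = q \<and> c \<le> sum_list (map e w)}"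
    have fW: "finite ?W"
      by (rule finite_subset[OF _ finite_lists_length_eq[OF S, of m]]) auto
    \<comment> \<open>Weights may cancel within a level, so the levels of all words in
      \<open>?W\<close> are added to those where \<open>g\<close> has a nonzero coefficient.\<close>
    define B where "B = {i. g i $ m \<noteq> 0} \<union> (\<lambda>w. sum_list (map e w) - c) ` ?W"
    have fB: "finite B" unfolding B_def using sg fW by (simp add: summable_seq_def)
    have "Sum_any (\<lambda>i. (if i \<ge> 0 then g i else 0) $ m) = (\<Sum>i\<in>B. (if i \<ge> 0 then g i else 0) $ m)"
      using fB by (intro Sum_any.expand_superset) (auto simp: B_def)
    also have "\<dots> = (\<Sum>i\<in>B. \<Sum>w\<in>{w \<in> ?W. sum_list (map e w) - c = i}. prod_list (map \<alpha> w))"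
    proof (rule sum.cong[OF refl])
      fix i
      have "{w \<in> ?W. sum_list (map e w) - c = i} = (if i \<ge> 0 then level_words m q (i + c) else {})"
        by (auto simp: level_words_def)
      then show "(if i \<ge> 0 then g i else 0) $ m =
          (\<Sum>w\<in>{w \<in> ?W. sum_list (map e w) - c = i}. prod_list (map \<alpha> w))"
        by (simp add: g_def level_gf_def)
    qed
    also have "\<dots> = (\<Sum>w\<in>?W. prod_list (map \<alpha> w))"
      using fW fB by (intro sum.group) (auto simp: B_def)
    finally show "Sum_any (\<lambda>i. (if i \<ge> 0 then g i else 0) $ m) = (\<Sum>w\<in>?W. prod_list (map \<alpha> w))" .
  qed
  ultimately show ?thesis by simp
qed

end

section \<open>Reachable points\<close>

lemma reachable_Nil [simp]: "reachable [] = {0}"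
  by (auto simp: reachable_def compatible_def)

lemma reachable_Cons: "reachable (s # w) = {a + b | a b. a \<in> s \<and> b \<in> reachable w}"
proof -
  have "compatible v (s # w) \<longleftrightarrow> (\<exists>a v'. v = a # v' \<and> a \<in> s \<and> compatible v' w)" for v
    by (auto simp: compatible_def list_all2_Cons2)
  then have *: "reachable (s # w) = {sum_list v | v. \<exists>a v'. v = a # v' \<and> a \<in> s \<and> compatible v' w}"
    by (simp add: reachable_def)
  show ?thesis
  proof (intro equalityI subsetI)
    fix x assume "x \<in> reachable (s # w)"
    then obtain a v' where "x = a + sum_list v'" "a \<in> s" "compatible v' w" unfolding * by auto
    then show "x \<in> {a + b | a b. a \<in> s \<and> b \<in> reachable w}" unfolding reachable_def by blast
  next
    fix x assume "x \<in> {a + b | a b. a \<in> s \<and> b \<in> reachable w}"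
    then obtain a v' where "x = sum_list (a # v')" "a \<in> s" "compatible v' w" unfolding reachable_def by auto
    then show "x \<in> reachable (s # w)" unfolding * by blast
  qed
qed

lemma reachable_append: "reachable (u @ w) = {a + b | a b. a \<in> reachable u \<and> b \<in> reachable w}"
proof (induction u)
  case (Cons s u)
  have "reachable ((s # u) @ w) = {a + (b + c) | a b c. a \<in> s \<and> b \<in> reachable u \<and> c \<in> reachable w}"
    unfolding append_Cons reachable_Cons Cons by blast
  also have "\<dots> = {a + b | a b. a \<in> reachable (s # u) \<and> b \<in> reachable w}"
    unfolding reachable_Cons add.assoc[symmetric] by blast
  finally show ?case .
qed auto

lemma reachable_Min_Max:
  assumes "\<forall>s\<in>set w. N_step s"
  shows "Min (reachable w) = sum_list (map Min w)" "Max (reachable w) = sum_list (map Max w)"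
proof -
  have "finite (reachable w) \<and> sum_list (map Min w) \<in> reachable w \<and> sum_list (map Max w) \<in> reachable w \<and>
    (\<forall>x\<in>reachable w. sum_list (map Min w) \<le> x \<and> x \<le> sum_list (map Max w))"
    using assms
  proof (induction w)
    case (Cons s w)
    then have s: "finite s" "s \<noteq> {}" by (auto simp: N_step_def)
    have "reachable (s # w) = (\<lambda>(a, b). a + b) ` (s \<times> reachable w)" by (auto simp: reachable_Cons)
    then have "finite (reachable (s # w))" using s Cons by simp
    moreover have "Min s \<in> s" "Max s \<in> s" "\<And>a. a \<in> s \<Longrightarrow> Min s \<le> a \<and> a \<le> Max s" using s by auto
    moreover have IH: "sum_list (map Min w) \<in> reachable w" "sum_list (map Max w) \<in> reachable w"
      "\<And>b. b \<in> reachable w \<Longrightarrow> sum_list (map Min w) \<le> b \<and> b \<le> sum_list (map Max w)"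
      using Cons by auto
    moreover have "sum_list (map Min (s # w)) \<le> x \<and> x \<le> sum_list (map Max (s # w))"
      if x: "x \<in> reachable (s # w)" for x
    proof -
      obtain a b where "x = a + b" "a \<in> s" "b \<in> reachable w" using x unfolding reachable_Cons by blast
      then show ?thesis using IH(3)[of b] s by (auto intro!: add_mono)
    qed
    moreover have "sum_list (map Min (s # w)) \<in> reachable (s # w)" "sum_list (map Max (s # w)) \<in> reachable (s # w)"
      using IH(1,2) \<open>Min s \<in> s\<close> \<open>Max s \<in> s\<close> by (auto simp: reachable_Cons)
    ultimately show ?case by blast
  qed auto
  then show "Min (reachable w) = sum_list (map Min w)" "Max (reachable w) = sum_list (map Max w)"
    by (auto intro: Min_eqI Max_eqI)
qed

text \<open>Minkowski sums commute, so only the multiplicities of the steps matter, and a reachable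
  point splits into one contribution for each element of \<open>S\<close>.\<close>

lemma reachable_count:
  assumes "finite S" "set w \<subseteq> S"
  shows "x \<in> reachable w \<longleftrightarrow>
    (\<exists>f. (\<forall>s\<in>S. f s \<in> reachable (replicate (count_list w s) s)) \<and> x = sum f S)"
  using assms(2)
proof (induction w arbitrary: x)
  case Nil
  then show ?case by (auto intro: exI[of _ "\<lambda>_. 0"])
next
  case (Cons s w)
  then have s: "s \<in> S" and IH: "y \<in> reachable w \<longleftrightarrow>
    (\<exists>f. (\<forall>s\<in>S. f s \<in> reachable (replicate (count_list w s) s)) \<and> y = sum f S)" for y by auto
  show ?case
  proof
    assume "x \<in> reachable (s # w)"
    then obtain a f where af: "a \<in> s" "\<forall>s\<in>S. f s \<in> reachable (replicate (count_list w s) s)" "x = a + sum f S"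
      unfolding reachable_Cons IH by blast
    let ?g = "\<lambda>r. f r + (if r = s then a else 0)"
    have "x = sum ?g S" using af s assms(1) by (simp add: sum.distrib sum.delta)
    moreover have "\<forall>r\<in>S. ?g r \<in> reachable (replicate (count_list (s # w) r) r)"
      using af by (auto simp: reachable_Cons) (metis add.commute)
    ultimately show "\<exists>f. (\<forall>r\<in>S. f r \<in> reachable (replicate (count_list (s # w) r) r)) \<and> x = sum f S"
      by - (rule exI[of _ ?g], intro conjI)
  next
    assume "\<exists>f. (\<forall>r\<in>S. f r \<in> reachable (replicate (count_list (s # w) r) r)) \<and> x = sum f S"
    then obtain f where f: "\<forall>r\<in>S. f r \<in> reachable (replicate (count_list (s # w) r) r)" "x = sum f S" by blast
    then have "f s \<in> reachable (s # replicate (count_list w s) s)" using s by auto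
    then obtain a b where ab: "a \<in> s" "b \<in> reachable (replicate (count_list w s) s)" "f s = a + b"
      unfolding reachable_Cons by blast
    let ?g = "\<lambda>r. f r + (if r = s then - a else 0)"
    have "x - a = sum ?g S" using f s assms(1) by (simp add: sum.distrib sum.delta)
    moreover have "?g r \<in> reachable (replicate (count_list w r) r)" if "r \<in> S" for r
      using bspec[OF f(1) that] ab by (cases "r = s") auto
    ultimately have "x - a \<in> reachable w" unfolding IH by - (rule exI[of _ ?g], intro conjI ballI)
    then show "x \<in> reachable (s # w)" using ab(1) unfolding reachable_Cons
      by (intro CollectI exI[of _ a] exI[of _ "x - a"]) simp
  qed
qed

section \<open>The n-fold sum of a single N-step\<close>

lemma sum_mult_add_at:
  fixes g k :: "'c \<Rightarrow> int"
  assumes "finite s" "a \<in> s"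
  shows "(\<Sum>b\<in>s. g b * (k b + (if b = a then c else 0))) = (\<Sum>b\<in>s. g b * k b) + g a * c"
proof -
  have "(\<Sum>b\<in>s. g b * (if b = a then c else 0)) = (\<Sum>b\<in>{a}. g b * (if b = a then c else 0))"
    using assms by (intro sum.mono_neutral_right) auto
  then show ?thesis by (simp only: distrib_left sum.distrib) simp
qed

text \<open>The number \<open>k b\<close> says how often \<open>b\<close> is chosen. It is an
  integer so that multiplicities can be subtracted and exchanged freely.\<close>

lemma reachable_replicate:
  assumes "finite s"
  shows "x \<in> reachable (replicate n s) \<longleftrightarrow>
    (\<exists>k :: int \<Rightarrow> int. (\<forall>b\<in>s. 0 \<le> k b) \<and> sum k s = int n \<and> (\<Sum>b\<in>s. b * k b) = x)"
proof (induction n arbitrary: x)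
  case 0
  show ?case
  proof
    assume "\<exists>k :: int \<Rightarrow> int. (\<forall>b\<in>s. 0 \<le> k b) \<and> sum k s = int 0 \<and> (\<Sum>b\<in>s. b * k b) = x"
    then show "x \<in> reachable (replicate 0 s)" using assms by (auto simp: sum_nonneg_eq_0_iff)
  qed (auto intro: exI[of _ "\<lambda>_. 0"])
next
  case (Suc n)
  show ?case
  proof
    assume "x \<in> reachable (replicate (Suc n) s)"
    then obtain a k where k: "a \<in> s" "\<forall>b\<in>s. 0 \<le> k b" "sum k s = int n" "x = a + (\<Sum>b\<in>s. b * k b)"
      by (auto simp: reachable_Cons Suc)
    show "\<exists>k :: int \<Rightarrow> int. (\<forall>b\<in>s. 0 \<le> k b) \<and> sum k s = int (Suc n) \<and> (\<Sum>b\<in>s. b * k b) = x"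
      using k sum_mult_add_at[OF assms k(1), of "\<lambda>b. b" k 1] sum_mult_add_at[OF assms k(1), of "\<lambda>_. 1" k 1]
      by (intro exI[of _ "\<lambda>b. k b + (if b = a then 1 else 0)"]) auto
  next
    assume "\<exists>k :: int \<Rightarrow> int. (\<forall>b\<in>s. 0 \<le> k b) \<and> sum k s = int (Suc n) \<and> (\<Sum>b\<in>s. b * k b) = x"
    then obtain k where k: "\<forall>b\<in>s. 0 \<le> k b" "sum k s = int (Suc n)" "(\<Sum>b\<in>s. b * k b) = x" by blast
    then obtain a where a: "a \<in> s" "k a \<noteq> 0" by (metis of_nat_0_eq_iff nat.distinct(1) sum.neutral)
    then have "k a \<ge> 1" using k by force
    let ?k = "\<lambda>b. k b + (if b = a then - 1 else 0)"
    have "\<forall>b\<in>s. 0 \<le> ?k b" "sum ?k s = int n" "(\<Sum>b\<in>s. b * ?k b) = x - a"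
      using k \<open>k a \<ge> 1\<close> sum_mult_add_at[OF assms a(1), of "\<lambda>b. b" k "- 1"]
        sum_mult_add_at[OF assms a(1), of "\<lambda>_. 1" k "- 1"]
      by auto
    then have "x - a \<in> reachable (replicate n s)" unfolding Suc by - (rule exI[of _ ?k], intro conjI)
    then show "x \<in> reachable (replicate (Suc n) s)" using a unfolding replicate_Suc reachable_Cons
      by (intro CollectI exI[of _ a] exI[of _ "x - a"]) simp
  qed
qed

text \<open>A progression with difference \<open>G\<close> inside the n-fold sum is recorded by the
  distances of its ends from the two extreme points. Unlike the ends themselves, these offsets can
  be compared for different \<open>n\<close>, and they all lie in one finite box.\<close>

definition progressions :: "nat \<Rightarrow> int \<Rightarrow> int set \<Rightarrow> nat \<Rightarrow> (int \<times> int) set" where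
  "progressions G C s n = {(a, b). 0 \<le> a \<and> a \<le> C \<and> 0 \<le> b \<and> b \<le> C \<and>
     int n * Min s + a \<le> int n * Max s - b \<and> int G dvd int n * Max s - b - (int n * Min s + a) \<and>
     (\<forall>x. int n * Min s + a \<le> x \<and> x \<le> int n * Max s - b \<and> int G dvd x - (int n * Min s + a)
       \<longrightarrow> x \<in> reachable (replicate n s))}"

lemma endpoints_reachable:
  assumes "N_step s" "0 \<le> i" "0 \<le> j" "i + j = int n"
  shows "i * Min s + j * Max s \<in> reachable (replicate n s)"
proof -
  have s: "finite s" "Min s \<in> s" "Max s \<in> s" using assms(1) by (auto simp: N_step_def)
  \<comment> \<open>The indicator terms are added, so the witness is also right when
    \<open>Min s = Max s\<close>.\<close>
  let ?k = "\<lambda>b. 0 + (if b = Min s then i else 0) + (if b = Max s then j else 0)"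
  have "(\<Sum>b\<in>s. g b * ?k b) = g (Min s) * i + g (Max s) * j" for g
    unfolding sum_mult_add_at[OF s(1,3)] sum_mult_add_at[OF s(1,2)] by simp
  from this[of "\<lambda>_. 1"] this[of "\<lambda>b. b"] show ?thesis
    unfolding reachable_replicate[OF s(1)] using assms(2-)
    by (intro exI[of _ ?k]) (auto simp: mult.commute)
qed

text \<open>An interior summand occurring \<^term>\<open>Max s - Min s\<close> times can be traded for endpoints without
  changing the sum, so few interior summands are needed; blocks of endpoints worth \<^term>\<open>G\<close> are then
  free to move.\<close>
lemma progressions_cover:
  assumes s: "N_step s" and G: "G > 0" "Max s - Min s \<noteq> 0 \<Longrightarrow> Max s - Min s dvd int G"
    and C: "int (card s) * (Max s - Min s) ^ 2 + int G \<le> C"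
    and x: "x \<in> reachable (replicate n s)"
  shows "\<exists>(a, b)\<in>progressions G C s n.
    int n * Min s + a \<le> x \<and> x \<le> int n * Max s - b \<and> int G dvd x - (int n * Min s + a)"
proof -
  define m M where "m = Min s" and "M = Max s"
  have fs: "finite s" "m \<in> s" "M \<in> s" and mM: "\<And>b. b \<in> s \<Longrightarrow> m \<le> b \<and> b \<le> M"
    using s by (auto simp: N_step_def m_def M_def)
  show ?thesis
  proof (cases "M = m")
    case True
    then have "s = {m}" using fs mM by (auto intro: antisym)
    then have r: "y \<in> reachable (replicate n s) \<longleftrightarrow> y = int n * m" for y
      by (auto simp: reachable_replicate intro!: exI[of _ "\<lambda>_. int n"])
    moreover have "0 \<le> C" using C by (smt (verit) G(1) of_nat_0_le_iff zero_le_mult_iff zero_le_power2)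
    ultimately have "(0, 0) \<in> progressions G C s n"
      using True by (auto simp: progressions_def m_def[symmetric] M_def[symmetric])
    then show ?thesis using x r True by (intro bexI[of _ "(0, 0)"]) (auto simp: m_def[symmetric] M_def[symmetric])
  next
    case False
    define d where "d = M - m"
    have d: "d > 0" using False mM fs by (force simp: d_def)
    \<comment> \<open>Exchanging \<open>c\<close> minima for maxima raises a sum by
      \<open>c * d\<close>, that is, by \<open>G\<close>.\<close>
    define c where "c = int G div d"
    have Gc: "int G = c * d" using G(2) d by (simp add: c_def d_def m_def M_def)
    have c: "c > 0" using Gc G(1) d by (metis of_nat_0_less_iff zero_less_mult_pos2)
    obtain k where k: "\<forall>b\<in>s. 0 \<le> k b" "sum k s = int n" "(\<Sum>b\<in>s. b * k b) = x"
      using x reachable_replicate[OF fs(1)] by blast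
    define I where "I = s - {m, M}"
    have fI: "finite I" using fs by (simp add: I_def)
    have sumI: "sum f s = f m + f M + sum f I" for f :: "int \<Rightarrow> int"
    proof -
      have "s = insert m (insert M I)" "m \<notin> I" "M \<notin> I" using fs by (auto simp: I_def)
      moreover from this have "sum f (insert m (insert M I)) = f m + f M + sum f I" using False fI by simp
      ultimately show ?thesis by metis
    qed
    \<comment> \<open>The trade: \<open>d\<close> copies of \<open>b\<close> have the same number
      and the same sum as \<open>M - b\<close> copies of \<open>m\<close> together with
      \<open>b - m\<close> copies of \<open>M\<close>. Fewer than \<open>d\<close> copies of each
      interior point remain.\<close>
    define kk where "kk = (\<lambda>b. k b mod d)"
    define q where "q = (\<lambda>b. k b div d)"
    have kq: "k b = kk b + d * q b" for b by (simp add: kk_def q_def)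
    have kk: "0 \<le> kk b" "kk b \<le> d" for b using d by (auto simp: kk_def intro: less_imp_le)
    have q0: "0 \<le> q b" if "b \<in> s" for b using k(1) that d by (auto simp: q_def pos_imp_zdiv_nonneg_iff)
    define n0 where "n0 = k m + (\<Sum>b\<in>I. q b * (M - b))"
    define n1 where "n1 = k M + (\<Sum>b\<in>I. q b * (b - m))"
    define L where "L = sum kk I"
    define V where "V = (\<Sum>b\<in>I. b * kk b)"
    have "0 \<le> n0" "0 \<le> n1" unfolding n0_def n1_def using k(1) fs mM q0
      by (auto simp: I_def intro!: add_nonneg_nonneg sum_nonneg mult_nonneg_nonneg)
    have nsum: "n0 + n1 + L = int n"
    proof -
      have "sum k I = L + (\<Sum>b\<in>I. q b * (M - b)) + (\<Sum>b\<in>I. q b * (b - m))"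
        unfolding L_def sum.distrib[symmetric] by (rule sum.cong) (simp_all add: kq d_def algebra_simps)
      then show ?thesis using k(2) by (simp add: sumI n0_def n1_def)
    qed
    have xsum: "V + m * n0 + M * n1 = x"
    proof -
      have "(\<Sum>b\<in>I. b * k b) = V + m * (\<Sum>b\<in>I. q b * (M - b)) + M * (\<Sum>b\<in>I. q b * (b - m))"
        unfolding V_def sum_distrib_left sum.distrib[symmetric]
        by (rule sum.cong) (simp_all add: kq d_def algebra_simps)
      then show ?thesis using k(3) by (simp add: sumI n0_def n1_def algebra_simps)
    qed
    \<comment> \<open>Endpoints are grouped in blocks of \<open>c\<close>. The
      \<open>j0 + j1\<close> full blocks may be moved to either end, while the remainders
      \<open>r0\<close> and \<open>r1\<close> stay put.\<close>
    define r0 r1 where "r0 = n0 mod c" and "r1 = n1 mod c"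
    define j0 j1 where "j0 = n0 div c" and "j1 = n1 div c"
    have n01: "n0 = r0 + c * j0" "n1 = r1 + c * j1" by (simp_all add: r0_def r1_def j0_def j1_def)
    have r: "0 \<le> r0" "r0 \<le> c" "0 \<le> r1" "r1 \<le> c"
      using c by (auto simp: r0_def r1_def intro: less_imp_le)
    have j: "0 \<le> j0" "0 \<le> j1"
      using c \<open>0 \<le> n0\<close> \<open>0 \<le> n1\<close> by (auto simp: j0_def j1_def pos_imp_zdiv_nonneg_iff)
    \<comment> \<open>These are the distances from the extremes when all full blocks are at
      \<open>m\<close>, respectively at \<open>M\<close>. The interior points and the leftover
      endpoints account for the two terms of the bound on \<open>C\<close>.\<close>
    define a where "a = (\<Sum>b\<in>I. (b - m) * kk b) + d * r1"
    define b where "b = (\<Sum>b\<in>I. (M - b) * kk b) + d * r0"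
    have lo: "int n * m + a = V + m * (r0 + c * j0 + c * j1) + M * r1"
    proof -
      have "(\<Sum>b\<in>I. (b - m) * kk b) = V - m * L"
        by (simp add: V_def L_def sum_distrib_left sum_subtractf algebra_simps)
      then show ?thesis unfolding a_def using nsum n01 by (simp add: d_def algebra_simps flip: nsum)
    qed
    have hi: "int n * M - b = V + m * r0 + M * (r1 + c * j0 + c * j1)"
    proof -
      have "(\<Sum>b\<in>I. (M - b) * kk b) = M * L - V"
        by (simp add: V_def L_def sum_distrib_left sum_subtractf algebra_simps)
      then show ?thesis unfolding b_def using nsum n01 by (simp add: d_def algebra_simps flip: nsum)
    qed
    have hl: "int n * M - b - (int n * m + a) = int G * (j0 + j1)"
      unfolding lo hi Gc by (simp add: d_def algebra_simps)
    have xl: "x - (int n * m + a) = int G * j1"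
      unfolding lo Gc by (simp add: d_def n01 algebra_simps flip: xsum)
    have cardI: "int (card I) \<le> int (card s)" using fs by (simp add: I_def card_mono)
    have bound: "(\<Sum>b\<in>I. f b * kk b) \<le> int (card s) * d ^ 2" "0 \<le> (\<Sum>b\<in>I. f b * kk b)"
      if "\<And>b. b \<in> I \<Longrightarrow> 0 \<le> f b \<and> f b \<le> d" for f
    proof -
      have "(\<Sum>b\<in>I. f b * kk b) \<le> (\<Sum>b\<in>I. d ^ 2)"
        unfolding power2_eq_square using that kk d by (intro sum_mono mult_mono) auto
      also have "\<dots> \<le> int (card s) * d ^ 2" using cardI by (simp add: mult_right_mono)
      finally show "(\<Sum>b\<in>I. f b * kk b) \<le> int (card s) * d ^ 2" .
      show "0 \<le> (\<Sum>b\<in>I. f b * kk b)" using that kk by (intro sum_nonneg mult_nonneg_nonneg) auto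
    qed
    have dr: "d * r0 \<le> int G" "d * r1 \<le> int G" "0 \<le> d * r0" "0 \<le> d * r1"
      unfolding Gc using r d by (auto simp: mult.commute)
    have C': "int (card s) * d ^ 2 + int G \<le> C" using C by (simp add: d_def m_def M_def)
    have a: "0 \<le> a" "a \<le> C" using bound[of "\<lambda>b. b - m"] mM dr C' by (auto simp: a_def d_def I_def)
    have b: "0 \<le> b" "b \<le> C" using bound[of "\<lambda>b. M - b"] mM dr C' by (auto simp: b_def d_def I_def)
    have prog: "y \<in> reachable (replicate n s)"
      if y: "int n * m + a \<le> y" "y \<le> int n * M - b" "int G dvd y - (int n * m + a)" for y
    proof -
      obtain l where l: "y = int n * m + a + int G * l" using y(3) by (metis add.commute diff_add_cancel dvdE)
      have "0 \<le> int G * l" "int G * l \<le> int G * (j0 + j1)" using y hl l by linarith+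
      then have l': "0 \<le> l" "l \<le> j0 + j1" using G(1) by (auto simp: zero_le_mult_iff)
      \<comment> \<open>Exactly \<open>l\<close> of the full blocks are placed at
        \<open>M\<close>.\<close>
      let ?k = "\<lambda>b. if b = m then r0 + c * (j0 + j1 - l) else if b = M then r1 + c * l else kk b"
      have "\<forall>b\<in>s. 0 \<le> ?k b" using r l' c kk by auto
      moreover have "sum ?k s = int n"
      proof -
        have "sum ?k I = L" unfolding L_def by (rule sum.cong) (auto simp: I_def)
        then show ?thesis using False nsum n01 by (simp add: sumI algebra_simps)
      qed
      moreover have "(\<Sum>b\<in>s. b * ?k b) = y"
      proof -
        have "(\<Sum>b\<in>I. b * ?k b) = V" unfolding V_def by (rule sum.cong) (auto simp: I_def)
        then show ?thesis unfolding l lo Gc using False by (simp add: sumI d_def algebra_simps)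
      qed
      ultimately show ?thesis unfolding reachable_replicate[OF fs(1)] by - (rule exI[of _ ?k], intro conjI)
    qed
    have "(a, b) \<in> progressions G C s n"
    proof -
      have "0 \<le> int G * (j0 + j1)" using j by simp
      then have "int n * m + a \<le> int n * M - b" "int G dvd int n * M - b - (int n * m + a)"
        using hl by (linarith, simp)
      then show ?thesis unfolding progressions_def m_def[symmetric] M_def[symmetric] using a b prog by blast
    qed
    moreover have "int n * m + a \<le> x" "x \<le> int n * M - b" "int G dvd x - (int n * m + a)"
    proof -
      have "0 \<le> int G * j1" "0 \<le> int G * j0" using j by simp_all
      then show "int n * m + a \<le> x" "x \<le> int n * M - b" using xl hl by (simp_all add: distrib_left)
      show "int G dvd x - (int n * m + a)" unfolding xl by simp
    qed
    ultimately show ?thesis by (intro bexI[of _ "(a, b)"]) (auto simp: m_def M_def)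
  qed
qed

text \<open>\<open>G\<close> new copies raise the lower end by \<open>G * Min s\<close> and the
  upper end by \<open>G * Max s\<close>. A point in the lower part is an old point plus
  \<open>G\<close> minima; a higher one is the old upper end plus a suitable mixture of new minima
  and maxima.\<close>

lemma progressions_mono:
  assumes s: "N_step s" and G: "G > 0" "Max s - Min s \<noteq> 0 \<Longrightarrow> Max s - Min s dvd int G"
  shows "progressions G C s n \<subseteq> progressions G C s (n + G)"
proof clarify
  fix a b assume "(a, b) \<in> progressions G C s n"
  then have ab: "0 \<le> a" "a \<le> C" "0 \<le> b" "b \<le> C" "int n * Min s + a \<le> int n * Max s - b"
    "int G dvd int n * Max s - b - (int n * Min s + a)"
    "\<And>x. int n * Min s + a \<le> x \<Longrightarrow> x \<le> int n * Max s - b \<Longrightarrow> int G dvd x - (int n * Min s + a)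
       \<Longrightarrow> x \<in> reachable (replicate n s)"
    by (auto simp: progressions_def)
  define d where "d = Max s - Min s"
  have d: "d \<ge> 0" using s by (auto simp: d_def N_step_def)
  have app: "u + v \<in> reachable (replicate (n + G) s)"
    if "u \<in> reachable (replicate n s)" "v \<in> reachable (replicate G s)" for u v
    unfolding replicate_add reachable_append using that by blast
  have "y \<in> reachable (replicate (n + G) s)"
    if y: "int (n + G) * Min s + a \<le> y" "y \<le> int (n + G) * Max s - b"
      "int G dvd y - (int (n + G) * Min s + a)" for y
  proof (cases "y - int G * Min s \<le> int n * Max s - b")
    case True
    have "y - int G * Min s - (int n * Min s + a) = y - (int (n + G) * Min s + a)" by (simp add: algebra_simps)
    then have "y - int G * Min s \<in> reachable (replicate n s)"
      using y True by (intro ab(7)) (auto simp: algebra_simps)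
    moreover have "int G * Min s \<in> reachable (replicate G s)"
      using endpoints_reachable[OF s, of "int G" 0] by simp
    ultimately show ?thesis using app by fastforce
  next
    case False
    define z where "z = y - (int n * Max s - b)"
    have "z - int G * Min s = (y - (int (n + G) * Min s + a)) - (int n * Max s - b - (int n * Min s + a))"
      by (simp add: z_def algebra_simps)
    then obtain j where j: "z - int G * Min s = int G * j" using y(3) ab(6) by (metis dvd_diff dvdE)
    have zp: "z - int G * Min s > 0" "z - int G * Min s \<le> int G * d"
      using False y(2) by (auto simp: z_def d_def algebra_simps)
    then have j': "0 < j" "j \<le> d" using j G(1) by (auto simp: zero_less_mult_iff)
    then obtain c where c: "int G = c * d" using G(2) by (metis d_def dvdE mult.commute order_less_le_trans order_less_irrefl)
    have "c \<ge> 0" using c G(1) j' by (metis of_nat_0_le_iff order_less_le_trans zero_le_mult_iff not_le)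
    \<comment> \<open>Each difference \<open>G\<close> above the sum of \<open>G\<close> minima
      costs \<open>c\<close> maxima, so \<open>c * j\<close> of the \<open>G\<close> new copies
      become maxima.\<close>
    have "c * j \<le> c * d" using \<open>c \<ge> 0\<close> j' by (simp add: mult_left_mono)
    then have "(int G - c * j) * Min s + c * j * Max s \<in> reachable (replicate G s)"
      using \<open>c \<ge> 0\<close> j' c by (intro endpoints_reachable[OF s]) auto
    moreover have "(int G - c * j) * Min s + c * j * Max s = z"
    proof -
      have "(int G - c * j) * Min s + c * j * Max s = int G * Min s + c * d * j"
        by (simp add: d_def algebra_simps)
      then show ?thesis using j c by simp
    qed
    moreover have "int n * Max s - b \<in> reachable (replicate n s)"
      using ab by (intro ab(7)) auto
    ultimately show ?thesis using app[of "int n * Max s - b" z] by (simp add: z_def)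
  qed
  moreover have "int (n + G) * Min s + a \<le> int (n + G) * Max s - b"
  proof -
    have "0 \<le> int G * d" using d by simp
    then show ?thesis using ab(5) by (simp add: d_def algebra_simps)
  qed
  moreover have "int G dvd int (n + G) * Max s - b - (int (n + G) * Min s + a)"
  proof -
    have "int (n + G) * Max s - b - (int (n + G) * Min s + a) =
      int n * Max s - b - (int n * Min s + a) + int G * (Max s - Min s)" by (simp add: algebra_simps)
    then show ?thesis using ab(6) by (metis dvd_add dvd_triv_left)
  qed
  ultimately show "(a, b) \<in> progressions G C s (n + G)" using ab(1-4) by (auto simp: progressions_def)
qed

text \<open>Along a residue class modulo \<open>G\<close> the sets increase inside a finite set, so
  their cardinality reaches a maximum; finitely many classes have a common bound.\<close>

lemma mono_period_stabilises:
  fixes F :: "nat \<Rightarrow> 'c set"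
  assumes "G > 0" "\<And>n. F n \<subseteq> F (n + G)" "\<And>n. F n \<subseteq> B" "finite B"
  shows "\<exists>N. \<forall>n\<ge>N. F (n + G) = F n"
proof -
  have mono: "F n \<subseteq> F (n + G * j)" for n j
  proof (induction j)
    case (Suc j)
    then show ?case using assms(2)[of "n + G * j"] by (simp add: algebra_simps)
  qed simp
  have "\<exists>J. \<forall>j\<ge>J. F (r + G * j) = F (r + G * J)" for r
  proof -
    define f where "f = (\<lambda>j. card (F (r + G * j)))"
    have fin: "finite (F n)" for n using assms(3,4) finite_subset by blast
    have "f j \<le> card B" for j unfolding f_def using assms(3,4) by (simp add: card_mono)
    then obtain J where J: "\<And>j. f j \<le> f J"
      using ex_has_greatest_nat[of "\<lambda>_. True" 0 f "Suc (card B)"] by (auto simp: less_Suc_eq_le)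
    have "F (r + G * j) = F (r + G * J)" if "j \<ge> J" for j
    proof -
      have "F (r + G * J) \<subseteq> F (r + G * j)"
        using mono[of "r + G * J" "j - J"] that by (simp add: add.assoc flip: distrib_left)
      then show ?thesis using J[of j] fin unfolding f_def by (metis card_seteq)
    qed
    then show ?thesis by blast
  qed
  then obtain J where J: "\<And>r j. j \<ge> J r \<Longrightarrow> F (r + G * j) = F (r + G * J r)" by metis
  define N where "N = G * Max (J ` {..<G})"
  have "F (n + G) = F n" if n: "n \<ge> N" for n
  proof -
    let ?r = "n mod G" let ?j = "n div G"
    have "Max (J ` {..<G}) \<le> ?j" using n assms(1) unfolding N_def
      by (metis div_le_mono nonzero_mult_div_cancel_left not_gr_zero)
    moreover have "J ?r \<le> Max (J ` {..<G})" using assms(1) by (intro Max_ge) auto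
    ultimately have "J ?r \<le> ?j" by simp
    moreover have "n = ?r + G * ?j" "n + G = ?r + G * Suc ?j" by simp_all
    ultimately show ?thesis using J[of ?r ?j] J[of ?r "Suc ?j"] by (metis le_SucI)
  qed
  then show ?thesis by blast
qed

text \<open>The determinant argument indexes states by naturals, so a general finite set of states
  is numbered.\<close>

lemma finite_state_gf_algebraic:
  fixes h :: "'b list \<Rightarrow> 'q" and k :: "'a::field fls set" and e :: "'b \<Rightarrow> int"
  assumes S: "finite S" and Q: "finite Q" "q \<in> Q"
    and h: "\<And>w. set w \<subseteq> S \<Longrightarrow> h w \<in> Q"
    and \<tau>: "\<And>w s. set w \<subseteq> S \<Longrightarrow> s \<in> S \<Longrightarrow> h (w @ [s]) = \<tau> (h w) s"
    and k: "subfield_set k" "\<And>a. fls_const a \<in> k" "fls_X \<in> k"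
  shows "fps_to_fls (Abs_fps (\<lambda>n. \<Sum>w\<in>{w. set w \<subseteq> S \<and> length w = n \<and> h w = q \<and> c \<le> sum_list (map e w)}.
    prod_list (map \<alpha> w))) \<in> subfield_set.algs k"
proof -
  obtain idx where idx: "bij_betw idx Q {0..<card Q}" using ex_bij_betw_finite_nat[OF Q(1)] by blast
  have lt: "idx p < card Q" if "p \<in> Q" for p
    using idx that by (auto simp: bij_betw_def)
  have inj: "inj_on idx Q" using idx by (simp add: bij_betw_def)
  have "fps_to_fls (Abs_fps (\<lambda>n. \<Sum>w\<in>{w. set w \<subseteq> S \<and> length w = n \<and> idx (h w) = idx q \<and> c \<le> sum_list (map e w)}.
    prod_list (map \<alpha> w))) \<in> subfield_set.algs k"
    by (rule automaton_gf_algebraic[where N = "card Q" and \<tau> = "\<lambda>i s. idx (\<tau> (inv_into Q idx i) s)"])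
      (use S h \<tau> lt k Q inj in \<open>auto simp: inv_into_f_f\<close>)
  moreover have "{w. set w \<subseteq> S \<and> length w = n \<and> idx (h w) = idx q \<and> c \<le> sum_list (map e w)} =
      {w. set w \<subseteq> S \<and> length w = n \<and> h w = q \<and> c \<le> sum_list (map e w)}" for n
    using h Q inj by (auto simp: inj_on_eq_iff)
  ultimately show ?thesis by simp
qed

text \<open>Greedy choice: each element takes as much of what remains as its capacity
  allows.\<close>

lemma split_bounded_sum:
  fixes J :: "'c \<Rightarrow> int"
  assumes "finite S" "\<And>s. s \<in> S \<Longrightarrow> 0 \<le> J s" "0 \<le> j" "j \<le> sum J S"
  shows "\<exists>f. (\<forall>s\<in>S. 0 \<le> f s \<and> f s \<le> J s) \<and> sum f S = j"
  using assms
proof (induction S arbitrary: j rule: finite_induct)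
  case (insert s S)
  define i where "i = min j (J s)"
  have "0 \<le> J s" using insert.prems by simp
  have "0 \<le> j - i" "j - i \<le> sum J S"
    using insert.prems(3) insert.hyps sum_nonneg[of S J] insert.prems(1) by (auto simp: i_def min_def)
  then have "\<exists>f. (\<forall>s\<in>S. 0 \<le> f s \<and> f s \<le> J s) \<and> sum f S = j - i"
    using insert.prems(1) by (intro insert.IH) auto
  then obtain f where "\<forall>s\<in>S. 0 \<le> f s \<and> f s \<le> J s" "sum f S = j - i" by blast
  moreover have "sum (f(s := i)) S = sum f S" using insert.hyps by (intro sum.cong) auto
  ultimately show ?case using insert.hyps insert.prems \<open>0 \<le> J s\<close>
    by (intro exI[of _ "f(s := i)"]) (auto simp: i_def)
qed auto

section \<open>Walks in one state, quadrants and bridges\<close>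

locale weighted_steps =
  fixes S :: "int set set" and \<alpha> :: "int set \<Rightarrow> 'a::field" and k :: "'a fls set"
  assumes finite_S: "finite S" and N_step_S: "\<And>s. s \<in> S \<Longrightarrow> N_step s"
    and k: "subfield_set k" "\<And>a. fls_const a \<in> k" "fls_X \<in> k"
begin

definition walk_gf :: "(int set list \<Rightarrow> bool) \<Rightarrow> 'a fps" where
  "walk_gf P = Abs_fps (\<lambda>n. \<Sum>w\<in>{w. set w \<subseteq> S \<and> length w = n \<and> P w}. prod_list (map \<alpha> w))"

text \<open>Algebraicity passes to disjoint unions and to differences of nested sets of walks.
  Intersections are not covered by these rules, which is why quadrants need their own
  argument.\<close>

definition algebraic_walks :: "(int set list \<Rightarrow> bool) \<Rightarrow> bool" where
  "algebraic_walks P \<longleftrightarrow> fps_to_fls (walk_gf P) \<in> subfield_set.algs k"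

lemma subfield_algs_k: "subfield_set (subfield_set.algs k)"
  by (rule subfield_set.subfield_algs[OF k(1)])

lemma finite_walks: "finite {w. set w \<subseteq> S \<and> length w = n \<and> P w}"
  by (rule finite_subset[OF _ finite_lists_length_eq[OF finite_S, of n]]) auto

lemma algebraic_walks_cong:
  assumes "\<And>w. set w \<subseteq> S \<Longrightarrow> P w \<longleftrightarrow> Q w"
  shows "algebraic_walks P \<longleftrightarrow> algebraic_walks Q"
proof -
  have "{w. set w \<subseteq> S \<and> length w = n \<and> P w} = {w. set w \<subseteq> S \<and> length w = n \<and> Q w}" for n
    using assms by auto
  then show ?thesis by (simp add: algebraic_walks_def walk_gf_def)
qed

lemma algebraic_walks_False: "algebraic_walks (\<lambda>_. False)"
proof -
  have "walk_gf (\<lambda>_. False) = 0" by (simp add: walk_gf_def fps_zero_def)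
  then show ?thesis using subfield_set.zero_mem[OF subfield_algs_k] by (simp add: algebraic_walks_def)
qed

lemma algebraic_walks_disj:
  assumes "algebraic_walks P" "algebraic_walks Q" "\<And>w. set w \<subseteq> S \<Longrightarrow> \<not> (P w \<and> Q w)"
  shows "algebraic_walks (\<lambda>w. P w \<or> Q w)"
proof -
  have "walk_gf (\<lambda>w. P w \<or> Q w) = walk_gf P + walk_gf Q"
  proof (rule fps_ext)
    fix n
    have "{w. set w \<subseteq> S \<and> length w = n \<and> (P w \<or> Q w)} =
        {w. set w \<subseteq> S \<and> length w = n \<and> P w} \<union> {w. set w \<subseteq> S \<and> length w = n \<and> Q w}" by auto
    moreover have "{w. set w \<subseteq> S \<and> length w = n \<and> P w} \<inter> {w. set w \<subseteq> S \<and> length w = n \<and> Q w} = {}"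
      using assms(3) by auto
    ultimately show "walk_gf (\<lambda>w. P w \<or> Q w) $ n = (walk_gf P + walk_gf Q) $ n"
      using finite_walks by (simp add: walk_gf_def sum.union_disjoint)
  qed
  then show ?thesis using assms(1,2) subfield_set.add_mem[OF subfield_algs_k]
    by (simp add: algebraic_walks_def)
qed

lemma algebraic_walks_diff:
  assumes "algebraic_walks P" "algebraic_walks Q" "\<And>w. set w \<subseteq> S \<Longrightarrow> Q w \<Longrightarrow> P w"
  shows "algebraic_walks (\<lambda>w. P w \<and> \<not> Q w)"
proof -
  have "walk_gf (\<lambda>w. P w \<and> \<not> Q w) = walk_gf P - walk_gf Q"
  proof (rule fps_ext)
    fix n
    have "{w. set w \<subseteq> S \<and> length w = n \<and> (P w \<and> \<not> Q w)} =
        {w. set w \<subseteq> S \<and> length w = n \<and> P w} - {w. set w \<subseteq> S \<and> length w = n \<and> Q w}" by auto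
    moreover have "{w. set w \<subseteq> S \<and> length w = n \<and> Q w} \<subseteq> {w. set w \<subseteq> S \<and> length w = n \<and> P w}"
      using assms(3) by auto
    ultimately show "walk_gf (\<lambda>w. P w \<and> \<not> Q w) $ n = (walk_gf P - walk_gf Q) $ n"
      using finite_walks by (simp add: walk_gf_def sum_diff)
  qed
  then show ?thesis using assms(1,2) subfield_set.diff_mem[OF subfield_algs_k]
    by (simp add: algebraic_walks_def)
qed

lemma algebraic_walks_Bex:
  assumes "finite I" "\<And>i. i \<in> I \<Longrightarrow> algebraic_walks (P i)"
    "\<And>i j w. P i w \<Longrightarrow> P j w \<Longrightarrow> i = j"
  shows "algebraic_walks (\<lambda>w. \<exists>i\<in>I. P i w)"
  using assms(1,2)
proof (induction I rule: finite_induct)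
  case empty
  then show ?case using algebraic_walks_False by simp
next
  case (insert i I)
  then have "algebraic_walks (\<lambda>w. P i w \<or> (\<exists>i\<in>I. P i w))"
    using assms(3) by (intro algebraic_walks_disj) auto
  then show ?case by simp
qed

text \<open>A common multiple of all widths serves as one difference for the progressions of all
  steps, so that these can be added. The factor 1 keeps one-point steps from making it zero.\<close>

definition period :: nat where
  "period = (\<Prod>s\<in>S. if Max s = Min s then 1 else nat (Max s - Min s))"

text \<open>Dominates the bound of \<open>progressions_cover\<close> for all steps at once.\<close>

definition slack :: int where
  "slack = (\<Sum>s\<in>S. int (card s) * (Max s - Min s) ^ 2) + int period"

definition progs :: "int set \<Rightarrow> nat \<Rightarrow> (int \<times> int) set" where
  "progs s n = progressions period slack s n"

lemma Min_le_Max: "s \<in> S \<Longrightarrow> Min s \<le> Max s"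
  using N_step_S by (simp add: N_step_def)

lemma period_pos: "period > 0"
  unfolding period_def
proof (rule prod_pos)
  fix s assume "s \<in> S"
  then have "Min s \<le> Max s" by (rule Min_le_Max)
  then show "0 < (if Max s = Min s then 1 else nat (Max s - Min s))" by simp
qed

lemma width_dvd_period:
  assumes "s \<in> S" "Max s - Min s \<noteq> 0"
  shows "Max s - Min s dvd int period"
proof -
  have "(if Max s = Min s then 1 else nat (Max s - Min s)) dvd period"
    unfolding period_def by (rule dvd_prodI[OF finite_S assms(1)])
  then have "nat (Max s - Min s) dvd period" using assms(2) by simp
  then have "int (nat (Max s - Min s)) dvd int period" by (simp only: int_dvd_int_iff)
  then show ?thesis using Min_le_Max[OF assms(1)] by simp
qed

lemma slack_ge: "s \<in> S \<Longrightarrow> int (card s) * (Max s - Min s) ^ 2 + int period \<le> slack"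
  unfolding slack_def using finite_S member_le_sum[of s S "\<lambda>s. int (card s) * (Max s - Min s) ^ 2"] by simp

lemma slack_nonneg: "0 \<le> slack"
  unfolding slack_def by (intro add_nonneg_nonneg sum_nonneg) auto

text \<open>The second condition is for quadrants: each coordinate of a corner is a sum of
  \<open>card S\<close> offsets, and twice such a sum has to stay within the threshold.\<close>

lemma ex_threshold:
  "\<exists>N. (\<forall>s\<in>S. \<forall>n\<ge>N. progs s (n + period) = progs s n) \<and> 2 * int (card S) * slack \<le> int N"
proof -
  have "\<exists>N. \<forall>n\<ge>N. progs s (n + period) = progs s n" if "s \<in> S" for s
    unfolding progs_def
  proof (rule mono_period_stabilises[OF period_pos])
    show "progressions period slack s n \<subseteq> progressions period slack s (n + period)" for n
      using that by (intro progressions_mono N_step_S period_pos width_dvd_period)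
    show "progressions period slack s n \<subseteq> {0..slack} \<times> {0..slack}" for n
      by (auto simp: progressions_def)
  qed simp
  then obtain N where N: "\<And>s n. s \<in> S \<Longrightarrow> n \<ge> N s \<Longrightarrow> progs s (n + period) = progs s n" by metis
  let ?N = "sum N S + nat (2 * int (card S) * slack)"
  have "N s \<le> ?N" if "s \<in> S" for s using finite_S that member_le_sum[of s S N] by simp
  then show ?thesis using N slack_nonneg by (intro exI[of _ ?N]) (auto intro: le_trans sum_nonneg)
qed

definition threshold :: nat where
  "threshold = (SOME N. (\<forall>s\<in>S. \<forall>n\<ge>N. progs s (n + period) = progs s n) \<and> 2 * int (card S) * slack \<le> int N)"

lemma threshold:
  "s \<in> S \<Longrightarrow> n \<ge> threshold \<Longrightarrow> progs s (n + period) = progs s n"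
  "2 * int (card S) * slack \<le> int threshold"
  using someI_ex[OF ex_threshold] unfolding threshold_def by blast+

text \<open>Counts below the threshold are kept exactly; of larger ones only the residue survives,
  represented in the interval of length \<open>period\<close> that starts at the threshold.\<close>

definition clip :: "nat \<Rightarrow> nat" where
  "clip n = (if n < threshold then n else threshold + (n - threshold) mod period)"

lemma clip_less: "clip n < threshold + period"
  using period_pos by (simp add: clip_def)

text \<open>The clipped count can be updated letter by letter, as an automaton requires.\<close>

lemma clip_Suc: "clip (Suc (clip n)) = clip (Suc n)"
  by (auto simp: clip_def Suc_diff_le mod_Suc_eq)

lemma clip_small: "clip n < threshold \<Longrightarrow> clip n = n"
  by (auto simp: clip_def split: if_splits)

lemma clip_large: "threshold \<le> clip n \<Longrightarrow> threshold \<le> n"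
  by (auto simp: clip_def split: if_splits)

lemma clip_decompose: "\<exists>j. n = clip n + period * j \<and> (j = 0 \<or> threshold \<le> clip n)"
proof (cases "n < threshold")
  case False
  then have "n = threshold + (n - threshold) mod period + period * ((n - threshold) div period)" by simp
  then show ?thesis using False
    by (intro exI[of _ "(n - threshold) div period"]) (simp add: clip_def)
qed (auto simp: clip_def)

lemma progs_clip:
  assumes "s \<in> S"
  shows "progs s (clip n) = progs s n"
proof -
  have "progs s (m + period * j) = progs s m" if "threshold \<le> m" for m j
  proof (induction j)
    case (Suc j)
    then show ?case using threshold(1)[OF assms, of "m + period * j"] that by (simp add: algebra_simps)
  qed simp
  then show ?thesis using clip_decompose[of n] by (metis add_0_right mult_0_right)
qed

lemma clip_cong: "int period dvd int n - int (clip n)"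
proof -
  obtain j where "n = clip n + period * j" using clip_decompose by blast
  then have "int n - int (clip n) = int period * int j"
    by (metis add_diff_cancel_left' of_nat_add of_nat_mult)
  then show ?thesis by simp
qed

text \<open>The value 0 outside \<open>S\<close> is a filler that keeps the set of states
  finite.\<close>

definition state :: "int set list \<Rightarrow> int set \<Rightarrow> nat" where
  "state w s = (if s \<in> S then clip (count_list w s) else 0)"

definition states :: "(int set \<Rightarrow> nat) set" where
  "states = {f. \<forall>s. (s \<in> S \<longrightarrow> f s \<in> {..<threshold + period}) \<and> (s \<notin> S \<longrightarrow> f s = 0)}"

lemma finite_states: "finite states"
  unfolding states_def by (rule finite_set_of_finite_funs) (auto simp: finite_S)

lemma state_mem: "state w \<in> states"
  using clip_less by (auto simp: states_def state_def)

text \<open>The weight \<open>e\<close> is arbitrary: the minimum, the negated maximum, and the zero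
  weight, for which \<open>c = 0\<close> imposes no bound, are all used.\<close>

lemma algebraic_state:
  fixes c :: int
  assumes "f \<in> states"
  shows "algebraic_walks (\<lambda>w. state w = f \<and> c \<le> sum_list (map e w))"
  unfolding algebraic_walks_def walk_gf_def
proof (rule finite_state_gf_algebraic[where Q = states and \<tau> = "\<lambda>f s. f(s := clip (Suc (f s)))"])
  show "state (w @ [s]) = (state w)(s := clip (Suc (state w s)))" if "s \<in> S" for w s
    using that by (auto simp: state_def fun_eq_iff clip_Suc)
qed (use finite_S finite_states assms state_mem k in auto)

lemma sum_list_count:
  assumes "set w \<subseteq> S"
  shows "sum_list (map g w) = (\<Sum>s\<in>S. g s * int (count_list w s))"
  using assms
proof (induction w)
  case (Cons a w)
  have "(\<Sum>s\<in>S. g s * int (count_list (a # w) s)) =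
      (\<Sum>s\<in>S. g s * (int (count_list w s) + (if s = a then 1 else 0)))"
    by (rule sum.cong) auto
  also have "\<dots> = sum_list (map g (a # w))"
    using Cons finite_S by (subst sum_mult_add_at) auto
  finally show ?case by simp
qed simp

text \<open>Progressions with a common difference add up to a progression whose ends are the sums of
  the ends. It contains 0 iff its lower end is divisible by the difference and 0 lies between the
  two ends.\<close>

lemma bridge_iff:
  assumes w: "set w \<subseteq> S"
  shows "0 \<in> reachable w \<longleftrightarrow> (\<exists>p. (\<forall>s\<in>S. p s \<in> progs s (count_list w s)) \<and>
    int period dvd sum_list (map Min w) + (\<Sum>s\<in>S. fst (p s)) \<and>
    sum_list (map Min w) \<le> - (\<Sum>s\<in>S. fst (p s)) \<and> (\<Sum>s\<in>S. snd (p s)) \<le> sum_list (map Max w))"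
    (is "?L \<longleftrightarrow> ?R")
proof -
  define n where "n = count_list w"
  have mn: "sum_list (map Min w) = (\<Sum>s\<in>S. int (n s) * Min s)"
    and mx: "sum_list (map Max w) = (\<Sum>s\<in>S. int (n s) * Max s)"
    unfolding sum_list_count[OF w] n_def by (simp_all add: mult.commute)
  show ?thesis
  proof
    assume ?L
    then obtain f where f: "\<forall>s\<in>S. f s \<in> reachable (replicate (n s) s)" "0 = sum f S"
      unfolding reachable_count[OF finite_S w] n_def by blast
    have "\<exists>p. p \<in> progs s (n s) \<and> int (n s) * Min s + fst p \<le> f s \<and> f s \<le> int (n s) * Max s - snd p \<and>
        int period dvd f s - (int (n s) * Min s + fst p)" if "s \<in> S" for s
    proof -
      have "\<exists>(a, b)\<in>progressions period slack s (n s). int (n s) * Min s + a \<le> f s \<and>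
          f s \<le> int (n s) * Max s - b \<and> int period dvd f s - (int (n s) * Min s + a)"
        using that f(1) by (intro progressions_cover N_step_S period_pos width_dvd_period slack_ge) auto
      then show ?thesis unfolding progs_def by fastforce
    qed
    then obtain p where p: "\<And>s. s \<in> S \<Longrightarrow> p s \<in> progs s (n s)"
      "\<And>s. s \<in> S \<Longrightarrow> int (n s) * Min s + fst (p s) \<le> f s"
      "\<And>s. s \<in> S \<Longrightarrow> f s \<le> int (n s) * Max s - snd (p s)"
      "\<And>s. s \<in> S \<Longrightarrow> int period dvd f s - (int (n s) * Min s + fst (p s))"
      by metis
    have "(\<Sum>s\<in>S. int (n s) * Min s + fst (p s)) \<le> sum f S" by (rule sum_mono) (rule p(2))
    moreover have "sum f S \<le> (\<Sum>s\<in>S. int (n s) * Max s - snd (p s))" by (rule sum_mono) (rule p(3))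
    moreover have "int period dvd (\<Sum>s\<in>S. f s - (int (n s) * Min s + fst (p s)))"
      by (rule dvd_sum) (rule p(4))
    ultimately show ?R using p(1) f(2) unfolding mn mx n_def[symmetric]
      by (intro exI[of _ p]) (auto simp: sum.distrib sum_subtractf dvd_minus_iff[of _ "_ + _", symmetric]
        simp del: dvd_minus_iff)
  next
    assume ?R
    then obtain p where p: "\<forall>s\<in>S. p s \<in> progs s (n s)"
      "int period dvd sum_list (map Min w) + (\<Sum>s\<in>S. fst (p s))"
      "sum_list (map Min w) \<le> - (\<Sum>s\<in>S. fst (p s))" "(\<Sum>s\<in>S. snd (p s)) \<le> sum_list (map Max w)"
      unfolding n_def by blast
    define lo hi where "lo = (\<lambda>s. int (n s) * Min s + fst (p s))" and "hi = (\<lambda>s. int (n s) * Max s - snd (p s))"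
    have P: "lo s \<le> hi s" "int period dvd hi s - lo s"
      "\<And>x. lo s \<le> x \<Longrightarrow> x \<le> hi s \<Longrightarrow> int period dvd x - lo s \<Longrightarrow> x \<in> reachable (replicate (n s) s)"
      if "s \<in> S" for s
      using bspec[OF p(1) that] unfolding progs_def progressions_def lo_def hi_def by auto
    have "\<exists>J. hi s - lo s = int period * J" if "s \<in> S" for s using P(2)[OF that] by (auto simp: dvd_def)
    then obtain J where J: "\<And>s. s \<in> S \<Longrightarrow> hi s - lo s = int period * J s" by metis
    have slo: "sum lo S = sum_list (map Min w) + (\<Sum>s\<in>S. fst (p s))" by (simp add: lo_def sum.distrib mn)
    have shi: "sum hi S = sum_list (map Max w) - (\<Sum>s\<in>S. snd (p s))" by (simp add: hi_def sum_subtractf mx)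
    \<comment> \<open>The point 0 lies \<open>j\<close> differences above the lowest one; these are
      distributed over the steps, with at most \<open>J s\<close> for \<open>s\<close>.\<close>
    obtain j where j: "- sum lo S = int period * j" using p(2) unfolding slo[symmetric] by (metis dvd_minus_iff dvdE)
    have "int period * sum J S = sum hi S - sum lo S"
      using J by (simp add: sum_distrib_left flip: sum_subtractf)
    then have "int period * j \<le> int period * sum J S" using j p(4) shi by linarith
    then have "j \<le> sum J S" using period_pos by simp
    moreover have "0 \<le> int period * j" using j p(3) slo by linarith
    then have "0 \<le> j" using period_pos by (simp add: zero_le_mult_iff)
    moreover have "0 \<le> J s" if "s \<in> S" for s
      using J[OF that] P(1)[OF that] period_pos by (smt (verit) of_nat_0_less_iff zero_le_mult_iff)
    ultimately obtain g where g: "\<And>s. s \<in> S \<Longrightarrow> 0 \<le> g s \<and> g s \<le> J s" "sum g S = j"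
      using split_bounded_sum[OF finite_S, of J j] by blast
    let ?f = "\<lambda>s. lo s + int period * g s"
    have "?f s \<in> reachable (replicate (n s) s)" if "s \<in> S" for s
    proof (rule P(3)[OF that])
      show "lo s \<le> ?f s" using g(1)[OF that] by simp
      have "int period * g s \<le> int period * J s" using g(1)[OF that] by (simp add: mult_left_mono)
      then show "?f s \<le> hi s" using J[OF that] by linarith
      show "int period dvd ?f s - lo s" by simp
    qed
    moreover have "0 = sum ?f S" using g(2) j by (simp add: sum.distrib flip: sum_distrib_left)
    ultimately show ?L unfolding reachable_count[OF finite_S w] n_def[symmetric]
      by - (rule exI[of _ ?f], intro conjI ballI)
  qed
qed

text \<open>Within one state, the sets of walks given by a lower bound on the minimum and those given by an
  upper bound on the maximum are comparable or disjoint: either the reachable points spread far apart, or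
  their spread is determined by the state.\<close>
lemma algebraic_quadrant:
  assumes f: "f \<in> states" and AB: "A + B \<le> int threshold"
  shows "algebraic_walks (\<lambda>w. state w = f \<and> sum_list (map Min w) \<le> - A \<and> B \<le> sum_list (map Max w))"
proof (cases "\<exists>s\<in>S. threshold \<le> f s \<and> Min s < Max s")
  case True
  then obtain s where s: "s \<in> S" "threshold \<le> f s" "Min s < Max s" by blast
  have spread: "int threshold \<le> sum_list (map Max w) - sum_list (map Min w)"
    if w: "set w \<subseteq> S" "state w = f" for w
  proof -
    have "threshold \<le> count_list w s" using s w(2) by (auto simp: state_def intro: clip_large)
    then have "int threshold \<le> (Max s - Min s) * int (count_list w s)"
      using s(3) mult_mono[of 1 "Max s - Min s" "int threshold" "int (count_list w s)"] by simp
    also have "\<dots> \<le> (\<Sum>s\<in>S. (Max s - Min s) * int (count_list w s))"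
      using finite_S s Min_le_Max by (intro member_le_sum) auto
    finally show ?thesis using w(1) by (simp add: sum_list_count sum_subtractf left_diff_distrib)
  qed
  \<comment> \<open>These are the complements of the two half-planes. A walk in both would have
    spread at most \<open>A + B - 2\<close>, below the threshold, so they are disjoint and can be
    subtracted in turn.\<close>
  let ?lo = "\<lambda>w. state w = f \<and> 1 - A \<le> sum_list (map Min w)"
  let ?hi = "\<lambda>w. state w = f \<and> 1 - B \<le> sum_list (map (\<lambda>s. - Max s) w)"
  have neg: "sum_list (map (\<lambda>s. - Max s) w) = - sum_list (map Max w)" for w :: "int set list"
    by (induction w) auto
  have all: "algebraic_walks (\<lambda>w. state w = f \<and> (0::int) \<le> sum_list (map (\<lambda>_. 0) w))"
    using f by (rule algebraic_state)
  have "algebraic_walks (\<lambda>w. ((state w = f \<and> (0::int) \<le> sum_list (map (\<lambda>_. 0) w)) \<and> \<not> ?lo w) \<and> \<not> ?hi w)"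
  proof (rule algebraic_walks_diff[OF algebraic_walks_diff[OF all] algebraic_state[OF f]])
    show "algebraic_walks ?lo" using f by (rule algebraic_state)
    show "(state w = f \<and> (0::int) \<le> sum_list (map (\<lambda>_. 0) w)) \<and> \<not> ?lo w" if "set w \<subseteq> S" "?hi w" for w
      using spread[of w] that AB by (auto simp: neg sum_list_0)
  qed (auto simp: sum_list_0)
  then show ?thesis
    by (rule algebraic_walks_cong[THEN iffD1, rotated]) (auto simp: neg sum_list_0)
next
  case False
  \<comment> \<open>Steps of positive width occur fewer than \<open>threshold\<close> times, so
    their clipped counts are exact; steps of width zero add nothing to the spread.\<close>
  define D where "D = (\<Sum>s\<in>S. (Max s - Min s) * int (f s))"
  have spread: "sum_list (map Max w) = sum_list (map Min w) + D" if w: "set w \<subseteq> S" "state w = f" for w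
  proof -
    have "(Max s - Min s) * int (count_list w s) = (Max s - Min s) * int (f s)" if "s \<in> S" for s
    proof (cases "f s < threshold")
      case True
      have "clip (count_list w s) = f s" using w(2) that by (auto simp: state_def)
      then show ?thesis using True clip_small[of "count_list w s"] by simp
    next
      case nl: False
      then have "Max s = Min s" using False that Min_le_Max[OF that] by force
      then show ?thesis by simp
    qed
    then have "(\<Sum>s\<in>S. (Max s - Min s) * int (count_list w s)) = D" unfolding D_def by (rule sum.cong[OF refl])
    then show ?thesis using w(1) by (simp add: sum_list_count sum_subtractf left_diff_distrib)
  qed
  \<comment> \<open>With constant spread the quadrant confines the minimum to the interval from
    \<open>B - D\<close> to \<open>- A\<close>. The \<open>max\<close> keeps the two bounds nested
    when this interval is empty.\<close>
  have "algebraic_walks (\<lambda>w. (state w = f \<and> B - D \<le> sum_list (map Min w)) \<and>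
      \<not> (state w = f \<and> max (1 - A) (B - D) \<le> sum_list (map Min w)))"
    by (rule algebraic_walks_diff[OF algebraic_state[OF f] algebraic_state[OF f]]) auto
  then show ?thesis
    by (rule algebraic_walks_cong[THEN iffD1, rotated]) (auto simp: spread)
qed

text \<open>Two quadrants meet in the quadrant whose corner is the componentwise maximum, so the
  overlap of one quadrant with the others is a union of fewer quadrants and can be subtracted. The
  bounds are set for each coordinate because they survive the maximum, unlike a bound on
  \<open>A + B\<close>.\<close>

lemma algebraic_quadrant_union:
  assumes f: "f \<in> states" and P: "finite P" "\<And>A B. (A, B) \<in> P \<Longrightarrow> 2 * A \<le> int threshold \<and> 2 * B \<le> int threshold"
  shows "algebraic_walks (\<lambda>w. \<exists>(A, B)\<in>P. state w = f \<and> sum_list (map Min w) \<le> - A \<and> B \<le> sum_list (map Max w))"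
  using P
proof (induction "card P" arbitrary: P rule: less_induct)
  case less
  let ?q = "\<lambda>(A, B) w. state w = f \<and> sum_list (map Min w) \<le> - A \<and> B \<le> sum_list (map Max w)"
  have mono: "algebraic_walks (?q p)" if "p \<in> P" for p
    using that less.prems(2)[of "fst p" "snd p"] algebraic_quadrant[OF f, of "fst p" "snd p"]
    by (cases p) auto
  show ?case
  proof (cases "P = {}")
    case True
    then show ?thesis using algebraic_walks_False by simp
  next
    case False
    then obtain A B where AB: "(A, B) \<in> P" by auto
    define P' where "P' = P - {(A, B)}"
    define P2 where "P2 = (\<lambda>(A', B'). (max A A', max B B')) ` P'"
    have P': "finite P'" "card P' < card P" "P = insert (A, B) P'"
      unfolding P'_def using less.prems(1) AB by (simp, rule card_Diff1_less, auto)
    have P2: "(\<exists>p\<in>P2. ?q p w) \<longleftrightarrow> ?q (A, B) w \<and> (\<exists>p\<in>P'. ?q p w)" for w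
    proof -
      have "m \<le> - max a b \<longleftrightarrow> m \<le> - a \<and> m \<le> - b" for m a b :: int by linarith
      then show ?thesis unfolding P2_def by (simp add: case_prod_beta') blast
    qed
    have c2: "card P2 < card P" using P' unfolding P2_def by (meson card_image_le le_less_trans)
    have "algebraic_walks (\<lambda>w. \<exists>(A, B)\<in>P'. state w = f \<and> sum_list (map Min w) \<le> - A \<and> B \<le> sum_list (map Max w))"
      using less.prems(2) P'(3) by (intro less.hyps[OF P'(2) P'(1)]) blast
    then have "algebraic_walks (\<lambda>w. \<exists>p\<in>P'. ?q p w)"
      by (simp add: case_prod_beta')
    moreover have "algebraic_walks (\<lambda>w. ?q (A, B) w \<and> \<not> (\<exists>p\<in>P2. ?q p w))"
    proof (rule algebraic_walks_diff[OF mono[OF AB]])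
      have "finite P2" using P' by (simp add: P2_def)
      moreover have "2 * A' \<le> int threshold \<and> 2 * B' \<le> int threshold" if "(A', B') \<in> P2" for A' B'
        using that less.prems(2) AB P'(3) by (fastforce simp: P2_def max_def split: if_splits)
      ultimately show "algebraic_walks (\<lambda>w. \<exists>p\<in>P2. ?q p w)"
        using less.hyps[OF c2] by (simp add: case_prod_beta')
    qed (simp add: P2)
    ultimately have "algebraic_walks (\<lambda>w. (\<exists>p\<in>P'. ?q p w) \<or> (?q (A, B) w \<and> \<not> (\<exists>p\<in>P2. ?q p w)))"
      by (rule algebraic_walks_disj) (auto simp: P2)
    then show ?thesis
      by (rule algebraic_walks_cong[THEN iffD1, rotated]) (auto simp: P2 P'(3))
  qed
qed

text \<open>In a fixed state the available offsets and the congruence in \<open>bridge_iff\<close>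
  are constant. What still depends on the walk are two inequalities for each choice of offsets, that
  is, a union of quadrants.\<close>

theorem algebraic_bridges: "algebraic_walks (\<lambda>w. 0 \<in> reachable w)"
proof -
  have "algebraic_walks (\<lambda>w. state w = f \<and> 0 \<in> reachable w)" if f: "f \<in> states" for f
  proof -
    define sel where "sel = {p. (\<forall>s\<in>S. p s \<in> progs s (f s)) \<and>
      int period dvd (\<Sum>s\<in>S. Min s * int (f s)) + (\<Sum>s\<in>S. fst (p s))}"
    define P where "P = (\<lambda>p. (\<Sum>s\<in>S. fst (p s), \<Sum>s\<in>S. snd (p s))) ` sel"
    have sel: "0 \<le> fst (p s)" "fst (p s) \<le> slack" "0 \<le> snd (p s)" "snd (p s) \<le> slack"
      if "p \<in> sel" "s \<in> S" for p s
      using that unfolding sel_def progs_def progressions_def by fastforce+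
    have Pb: "0 \<le> A \<and> A \<le> int (card S) * slack \<and> 0 \<le> B \<and> B \<le> int (card S) * slack" if "(A, B) \<in> P" for A B
      using that sel unfolding P_def
      by (auto intro!: sum_nonneg sum_bounded_above)
    \<comment> \<open>\<open>sel\<close> leaves \<open>p\<close> free outside \<open>S\<close> and
      may be infinite; only the corners are finite in number.\<close>
    have "P \<subseteq> {0..int (card S) * slack} \<times> {0..int (card S) * slack}" using Pb by auto
    then have "finite P" by (rule finite_subset) auto
    then have "algebraic_walks (\<lambda>w. \<exists>(A, B)\<in>P. state w = f \<and> sum_list (map Min w) \<le> - A \<and> B \<le> sum_list (map Max w))"
      using Pb threshold(2) by (intro algebraic_quadrant_union[OF f]) fastforce+
    then show ?thesis
    proof (rule algebraic_walks_cong[THEN iffD1, rotated])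
      fix w assume w: "set w \<subseteq> S"
      show "(\<exists>(A, B)\<in>P. state w = f \<and> sum_list (map Min w) \<le> - A \<and> B \<le> sum_list (map Max w)) \<longleftrightarrow>
        state w = f \<and> 0 \<in> reachable w"
      proof (cases "state w = f")
        case True
        then have fc: "f s = clip (count_list w s)" if "s \<in> S" for s using that by (auto simp: state_def)
        have pr: "progs s (count_list w s) = progs s (f s)" if "s \<in> S" for s
          using fc[OF that] progs_clip[OF that] by simp
        \<comment> \<open>Clipping changes a count by a multiple of the period, so the state
          determines the minimum modulo the period.\<close>
        have "int period dvd (\<Sum>s\<in>S. Min s * (int (count_list w s) - int (f s)))"
          using fc clip_cong by (intro dvd_sum dvd_mult) simp
        then have "int period dvd sum_list (map Min w) - (\<Sum>s\<in>S. Min s * int (f s))"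
          unfolding sum_list_count[OF w] by (simp add: sum_subtractf right_diff_distrib)
        then have "int period dvd sum_list (map Min w) + a \<longleftrightarrow> int period dvd (\<Sum>s\<in>S. Min s * int (f s)) + a" for a
          using dvd_add_right_iff[of "int period" "sum_list (map Min w) - (\<Sum>s\<in>S. Min s * int (f s))"
              "(\<Sum>s\<in>S. Min s * int (f s)) + a"] by simp
        then have "p \<in> sel \<longleftrightarrow> (\<forall>s\<in>S. p s \<in> progs s (count_list w s)) \<and>
            int period dvd sum_list (map Min w) + (\<Sum>s\<in>S. fst (p s))" for p
          unfolding sel_def using pr by simp
        then have "0 \<in> reachable w \<longleftrightarrow> (\<exists>p\<in>sel. sum_list (map Min w) \<le> - (\<Sum>s\<in>S. fst (p s)) \<and>
            (\<Sum>s\<in>S. snd (p s)) \<le> sum_list (map Max w))"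
          unfolding bridge_iff[OF w] by blast
        then show ?thesis using True by (simp add: P_def)
      qed auto
    qed
  qed
  then have "algebraic_walks (\<lambda>w. \<exists>f\<in>states. state w = f \<and> 0 \<in> reachable w)"
    by (intro algebraic_walks_Bex finite_states) auto
  then show ?thesis
    by (rule algebraic_walks_cong[THEN iffD1, rotated]) (auto simp: state_mem)
qed

end

section \<open>Algebraicity over the rational functions\<close>

lemma to_fract_sum: "to_fract (sum f A) = (\<Sum>x\<in>A. to_fract (f x))"
  by (induction A rule: infinite_finite_induct) auto

lemma embed_xyt_nth: "embed_xyt c $ n = to_fract (coeff c n)"
  by (simp add: embed_xyt_def coeff_map_poly)

lemma embed_xyt_add: "embed_xyt (c + d) = embed_xyt c + embed_xyt d"
  by (rule fps_ext) (simp add: embed_xyt_nth)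

lemma embed_xyt_mult: "embed_xyt (c * d) = embed_xyt c * embed_xyt d"
  by (rule fps_ext)
    (simp add: embed_xyt_nth fps_mult_nth coeff_mult to_fract_sum atLeast0AtMost)

lemma embed_xyt_eq_0_iff: "embed_xyt c = 0 \<longleftrightarrow> c = 0"
proof
  assume "embed_xyt c = 0"
  then have "coeff c n = 0" for n
    using embed_xyt_nth[of c n] by simp
  then show "c = 0" by (simp add: poly_eq_iff)
qed (simp add: embed_xyt_def)

definition fls_embed :: "rat poly poly poly \<Rightarrow> ratfun_xy fls" where
  "fls_embed c = fps_to_fls (embed_xyt c)"

lemma fls_embed_add: "fls_embed (c + d) = fls_embed c + fls_embed d"
  and fls_embed_mult: "fls_embed (c * d) = fls_embed c * fls_embed d"
  and fls_embed_eq_0_iff: "fls_embed c = 0 \<longleftrightarrow> c = 0"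
  by (simp_all add: fls_embed_def embed_xyt_add embed_xyt_mult embed_xyt_eq_0_iff fls_times_fps_to_fls)

lemma fls_embed_0 [simp]: "fls_embed 0 = 0"
  by (simp add: fls_embed_eq_0_iff)

lemma fls_embed_const: "fls_embed [:p:] = fls_const (to_fract p)"
  by (simp add: fls_embed_def embed_xyt_def map_poly_pCons fps_of_poly_const fps_const_to_fls)

lemma fls_embed_1 [simp]: "fls_embed 1 = 1"
  using fls_embed_const[of 1] by (simp flip: one_pCons)

lemma fls_embed_uminus: "fls_embed (- c) = - fls_embed c"
  using fls_embed_add[of c "- c"] by (simp add: add_eq_0_iff)

text \<open>The field Q(x,y,t), realised inside the Laurent series in t.\<close>

definition ratfun_xyt :: "ratfun_xy fls set" where
  "ratfun_xyt = {fls_embed u / fls_embed v | u v. v \<noteq> 0}"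

lemma ratfun_xytI: "v \<noteq> 0 \<Longrightarrow> x = fls_embed u / fls_embed v \<Longrightarrow> x \<in> ratfun_xyt"
  by (auto simp: ratfun_xyt_def)

lemma subfield_ratfun_xyt: "subfield_set ratfun_xyt"
proof
  show "0 \<in> ratfun_xyt" "1 \<in> ratfun_xyt"
    by (rule ratfun_xytI[of 1 _ 0] ratfun_xytI[of 1 _ 1]; simp)+
  fix x assume "x \<in> ratfun_xyt"
  then obtain u v where uv: "v \<noteq> 0" "x = fls_embed u / fls_embed v" by (auto simp: ratfun_xyt_def)
  show "- x \<in> ratfun_xyt" using uv by (intro ratfun_xytI[of v _ "- u"]) (auto simp: fls_embed_uminus)
  show "inverse x \<in> ratfun_xyt"
  proof (cases "u = 0")
    case True
    then show ?thesis using uv by (intro ratfun_xytI[of 1 _ 0]) auto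
  next
    case False
    then show ?thesis using uv by (intro ratfun_xytI[of u _ v]) auto
  qed
  fix y assume "y \<in> ratfun_xyt"
  then obtain u' v' where uv': "v' \<noteq> 0" "y = fls_embed u' / fls_embed v'" by (auto simp: ratfun_xyt_def)
  show "x + y \<in> ratfun_xyt" using uv uv'
    by (intro ratfun_xytI[of "v * v'" _ "u * v' + u' * v"])
      (auto simp: fls_embed_add fls_embed_mult fls_embed_eq_0_iff add_frac_eq)
  show "x * y \<in> ratfun_xyt" using uv uv'
    by (intro ratfun_xytI[of "v * v'" _ "u * u'"]) (auto simp: fls_embed_mult)
qed

lemma fls_const_mem_ratfun_xyt: "fls_const a \<in> ratfun_xyt"
proof -
  obtain p q where pq: "a = Fraction_Field.Fract p q" "q \<noteq> 0" by (cases a) auto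
  then have "a = to_fract p / to_fract q" by (simp add: to_fract_def)
  then have "fls_const a = fls_embed [:p:] / fls_embed [:q:]"
    by (simp add: fls_embed_const fls_const_divide_const)
  then show ?thesis using pq by (intro ratfun_xytI[of "[:q:]"]) auto
qed

lemma fls_X_mem_ratfun_xyt: "fls_X \<in> ratfun_xyt"
  by (rule ratfun_xytI[of 1 _ "[:0, 1:]"])
    (simp_all add: fls_embed_def embed_xyt_def map_poly_pCons)

text \<open>The denominators of the coefficients are multiplied together; this turns an equation
  over Q(x,y,t) into one over Q[x,y,t].\<close>

lemma clear_denominators:
  assumes "\<And>i. coeff P i \<in> ratfun_xyt"
  shows "\<exists>D Q. D \<noteq> 0 \<and> smult (fls_embed D) P = map_poly fls_embed Q"
  using assms
proof (induction P)
  case 0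
  then show ?case by (intro exI[of _ 1] exI[of _ 0]) simp
next
  case (pCons a P)
  have "coeff P i \<in> ratfun_xyt" for i using pCons.prems[of "Suc i"] by simp
  then obtain D Q where DQ: "D \<noteq> 0" "smult (fls_embed D) P = map_poly fls_embed Q"
    using pCons.IH by blast
  obtain u v where uv: "v \<noteq> 0" "a = fls_embed u / fls_embed v"
    using pCons.prems[of 0] by (auto simp: ratfun_xyt_def)
  have "smult (fls_embed (v * D)) P = smult (fls_embed v) (map_poly fls_embed Q)"
    by (simp add: fls_embed_mult flip: DQ(2))
  also have "\<dots> = map_poly fls_embed (smult v Q)"
    by (rule poly_eqI) (simp add: coeff_map_poly fls_embed_mult)
  finally have "smult (fls_embed (v * D)) (pCons a P) = map_poly fls_embed (pCons (u * D) (smult v Q))"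
    using uv by (simp add: map_poly_pCons fls_embed_mult fls_embed_eq_0_iff)
  then show ?case using uv DQ by (intro exI[of _ "v * D"]) auto
qed

lemma algebraic_xyt_if_algs:
  assumes "fps_to_fls F \<in> subfield_set.algs ratfun_xyt"
  shows "algebraic_xyt F"
proof -
  interpret subfield_set ratfun_xyt by (rule subfield_ratfun_xyt)
  obtain P where P: "P \<noteq> 0" "\<And>i. coeff P i \<in> ratfun_xyt" "poly P (fps_to_fls F) = 0"
    using assms unfolding algs_def by blast
  obtain D Q where DQ: "D \<noteq> 0" "smult (fls_embed D) P = map_poly fls_embed Q"
    using clear_denominators[OF P(2)] by blast
  have "smult (fls_embed D) P \<noteq> 0" using P(1) DQ(1) by (simp add: fls_embed_eq_0_iff)
  then have "Q \<noteq> 0" unfolding DQ(2) by auto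
  have "poly (map_poly fls_embed Q) (fps_to_fls F) = fps_to_fls (poly (map_poly embed_xyt Q) F)" for Q
    by (induction Q) (simp_all add: map_poly_pCons embed_xyt_def fls_embed_def fls_times_fps_to_fls)
  moreover have "poly (map_poly fls_embed Q) (fps_to_fls F) = 0"
    by (simp add: P(3) flip: DQ(2))
  ultimately have "poly (map_poly embed_xyt Q) F = 0" by simp
  then show ?thesis unfolding algebraic_xyt_def using \<open>Q \<noteq> 0\<close> by blast
qed

text \<open>Minimum and maximum add up along a walk, so x and y become a multiplicative weight on
  steps with values in the coefficient field. Exponents may be negative, hence the appeal to nonzero
  variables.\<close>

lemma weight_eq:
  assumes "\<forall>s\<in>set w. N_step s"
  shows "prod_list (map (\<lambda>s. var_x powi Min s * var_y powi Max s) w) =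
    var_x powi Min (reachable w) * var_y powi Max (reachable w)"
proof -
  have nz: "var_x \<noteq> 0" "var_y \<noteq> 0" by (simp_all add: var_x_def var_y_def)
  have "prod_list (map (\<lambda>s. var_x powi Min s * var_y powi Max s) w) =
    var_x powi sum_list (map Min w) * var_y powi sum_list (map Max w)"
    by (induction w) (simp_all add: power_int_add nz mult_ac)
  then show ?thesis by (simp add: reachable_Min_Max[OF assms])
qed

theorem theorem4p1:
  fixes S :: "int set set"
  assumes "finite S" and "\<forall>s\<in>S. N_step s"
  shows "algebraic_xyt (N_bridge_gf S)"
proof -
  interpret weighted_steps S "\<lambda>s. var_x powi Min s * var_y powi Max s" ratfun_xyt
    by (rule weighted_steps.intro)
      (use assms subfield_ratfun_xyt fls_const_mem_ratfun_xyt fls_X_mem_ratfun_xyt in auto)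
  have "N_bridge_gf S = walk_gf (\<lambda>w. 0 \<in> reachable w)"
    unfolding N_bridge_gf_def walk_gf_def
  proof (intro arg_cong[of _ _ Abs_fps] ext sum.cong)
    fix n w assume "w \<in> {w. set w \<subseteq> S \<and> length w = n \<and> 0 \<in> reachable w}"
    then show "var_x powi Min (reachable w) * var_y powi Max (reachable w) =
      prod_list (map (\<lambda>s. var_x powi Min s * var_y powi Max s) w)"
      using assms(2) by (subst weight_eq) auto
  qed (auto simp: N_bridges_def N_walks_def)
  then show ?thesis
    using algebraic_bridges algebraic_xyt_if_algs by (simp add: algebraic_walks_def)
qed

end
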